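(* Let $J$ be the ideal of a non-trivial tetrahedral curve $(a_1,\dots,a_6)$. (a) If the curve is minimal, then $J$ has a linear resolution, and hence is componentwise linear. (b) If, up to a permutation of the variables, the curve is $(0,r,r,r,r,0)$ for some $r\ge 1$, then $J$ has a pure resolution that is not linear, and hence $J$ is not componentwise linear. (c) Suppose the curve is not minimal, and that $J$ reduces to a tetrahedral curve with ideal $I$ by one of the reductions (A), (B), (C), (D), applied at a facet of maximal weight, so that $J=L\cdot I+(F)$ with $L$ and $F$ the linear form and monomial prescribed by that reduction. Then $F$ is a minimal generator of $I$ if and only if, up to a permutation of the variables, the curve of $J$ is $(0,r,r,r,r,0)$ for some $r\ge1$.
   Context: Let $k$ be a field and $R=k[a,b,c,d]$. For nonnegative integers $a_1,\dots,a_6$, the tetrahedral curve $(a_1,\dots,a_6)$ is the curve in $\mathbb P^3$ with ideal $(a,b)^{a_1}\cap(a,c)^{a_2}\cap(a,d)^{a_3}\cap(b,c)^{a_4}\cap(b,d)^{a_5}\cap(c,d)^{a_6}$; it is trivial if all $a_i=0$. A permutation of $a,b,c,d$ permutes these six ideals and hence the entries of the 6-tuple. The four facets are the triples of entries $\{a_1,a_2,a_3\}$, $\{a_1,a_4,a_5\}$, $\{a_2,a_4,a_6\}$, $\{a_3,a_5,a_6\}$; the weight of a facet is the sum of its entries. Put $a_i'=\max\{0,a_i-1\}$. Reductions: (A) if $a_1+a_2\ge a_4$, $a_1+a_3\ge a_5$, $a_2+a_3\ge a_6$, then $J=a\cdot I+(b^{a_1}c^{a_2}d^{a_3})$ with $I$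 the ideal of $(a_1',a_2',a_3',a_4,a_5,a_6)$; (B) if $a_1+a_4\ge a_2$, $a_1+a_5\ge a_3$, $a_4+a_5\ge a_6$, then $J=b\cdot I+(a^{a_1}c^{a_4}d^{a_5})$ with $I$ the ideal of $(a_1',a_2,a_3,a_4',a_5',a_6)$; (C) if $a_2+a_4\ge a_1$, $a_2+a_6\ge a_3$, $a_4+a_6\ge a_5$, then $J=c\cdot I+(a^{a_2}b^{a_4}d^{a_6})$ with $I$ the ideal of $(a_1,a_2',a_3,a_4',a_5,a_6')$; (D) if $a_3+a_5\ge a_1$, $a_3+a_6\ge a_2$, $a_5+a_6\ge a_4$, then $J=d\cdot I+(a^{a_3}b^{a_5}c^{a_6})$ with $I$ the ideal of $(a_1,a_2,a_3',a_4,a_5',a_6')$. Reduction (A),(B),(C),(D) is "at" the facet $\{a_1,a_2,a_3\}$, $\{a_1,a_4,a_5\}$, $\{a_2,a_4,a_6\}$, $\{a_3,a_5,a_6\}$ respectively. A non-arithmetically Cohen–Macaulay tetrahedral curve is minimal if none of the reductions (A)–(D) applies. (Known: if a non-trivial tetrahedral curve is not minimal, a reduction at any facet of maximal weight is possible.) A homogeneous ideal has a linear resolution if it is generated in one degree $d$ and the $i$-th module of its minimal free resolution is generated in degree $d+i$; it is componentwise linear if for every $d$ the ideal generated by its degree-$d$ component has a linear resolution. *)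

theory Defs
  imports "HOL-Library.Poly_Mapping"
begin

datatype var = A | B | C | D

type_synonym 'k mpoly4 = "(var \<Rightarrow>\<^sub>0 nat) \<Rightarrow>\<^sub>0 'k"

definition X :: "var \<Rightarrow> 'k::comm_ring_1 mpoly4" where
  "X v = Poly_Mapping.single (Poly_Mapping.single v 1) 1"

definition mdeg :: "(var \<Rightarrow>\<^sub>0 nat) \<Rightarrow> nat" where
  "mdeg m = (\<Sum>v\<in>Poly_Mapping.keys m. Poly_Mapping.lookup m v)"

text \<open>p is homogeneous of (integer) degree e (the zero polynomial is homogeneous of every degree).\<close>
definition homog :: "'k::comm_ring_1 mpoly4 \<Rightarrow> int \<Rightarrow> bool" where
  "homog p e \<longleftrightarrow> (\<forall>m\<in>Poly_Mapping.keys p. int (mdeg m) = e)"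

definition const_coeff :: "'k::comm_ring_1 mpoly4 \<Rightarrow> 'k" where
  "const_coeff p = Poly_Mapping.lookup p 0"

definition ideal_gen :: "'k::comm_ring_1 mpoly4 set \<Rightarrow> 'k mpoly4 set" where
  "ideal_gen S = {p. \<exists>G c. finite G \<and> G \<subseteq> S \<and> p = (\<Sum>g\<in>G. c g * g)}"

text \<open>A tetrahedral curve (a_1,...,a_6) is a function a :: nat => nat, of which
  only the values a 1, ..., a 6 are used.  pair i gives the two variables of the
  i-th ideal: (a,b),(a,c),(a,d),(b,c),(b,d),(c,d).\<close>

definition pair :: "nat \<Rightarrow> var \<times> var" where
  "pair i = (if i = 1 then (A,B) else if i = 2 then (A,C) else if i = 3 then (A,D)
     else if i = 4 then (B,C) else if i = 5 then (B,D) else (C,D))"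

definition pow_ideal :: "var \<Rightarrow> var \<Rightarrow> nat \<Rightarrow> 'k::comm_ring_1 mpoly4 set" where
  "pow_ideal u v n = ideal_gen {X u ^ i * X v ^ (n - i) | i. i \<le> n}"

definition tet_ideal :: "(nat \<Rightarrow> nat) \<Rightarrow> 'k::comm_ring_1 mpoly4 set" where
  "tet_ideal a = (\<Inter>i\<in>{1..6}. pow_ideal (fst (pair i)) (snd (pair i)) (a i))"

definition nontrivial :: "(nat \<Rightarrow> nat) \<Rightarrow> bool" where
  "nontrivial a \<longleftrightarrow> (\<exists>i\<in>{1..6}. a i \<noteq> 0)"

definition perm_rel :: "(var \<Rightarrow> var) \<Rightarrow> (nat \<Rightarrow> nat) \<Rightarrow> (nat \<Rightarrow> nat) \<Rightarrow> bool" where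
  "perm_rel \<sigma> a b \<longleftrightarrow> (\<forall>i\<in>{1..6}. \<forall>j\<in>{1..6}.
      {\<sigma> (fst (pair j)), \<sigma> (snd (pair j))} = {fst (pair i), snd (pair i)} \<longrightarrow> b i = a j)"

definition special_curve :: "nat \<Rightarrow> (nat \<Rightarrow> nat)" where
  "special_curve r i = (if i = 1 \<or> i = 6 then 0 else r)"

definition up_to_perm_special :: "(nat \<Rightarrow> nat) \<Rightarrow> bool" where
  "up_to_perm_special a \<longleftrightarrow> (\<exists>\<sigma> r. bij \<sigma> \<and> r \<ge> 1 \<and> perm_rel \<sigma> (special_curve r) a)"

text \<open>Reductions (A),(B),(C),(D) are labelled by the variable A,B,C,D (the linear form L).\<close>

definition facet :: "var \<Rightarrow> nat set" where
  "facet v = (case v of A \<Rightarrow> {1,2,3} | B \<Rightarrow> {1,4,5} | C \<Rightarrow> {2,4,6} | D \<Rightarrow> {3,5,6})"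

definition weight :: "var \<Rightarrow> (nat \<Rightarrow> nat) \<Rightarrow> nat" where
  "weight v a = (\<Sum>i\<in>facet v. a i)"

definition red_cond :: "var \<Rightarrow> (nat \<Rightarrow> nat) \<Rightarrow> bool" where
  "red_cond v a = (case v of
       A \<Rightarrow> a 1 + a 2 \<ge> a 4 \<and> a 1 + a 3 \<ge> a 5 \<and> a 2 + a 3 \<ge> a 6
     | B \<Rightarrow> a 1 + a 4 \<ge> a 2 \<and> a 1 + a 5 \<ge> a 3 \<and> a 4 + a 5 \<ge> a 6
     | C \<Rightarrow> a 2 + a 4 \<ge> a 1 \<and> a 2 + a 6 \<ge> a 3 \<and> a 4 + a 6 \<ge> a 5
     | D \<Rightarrow> a 3 + a 5 \<ge> a 1 \<and> a 3 + a 6 \<ge> a 2 \<and> a 5 + a 6 \<ge> a 4)"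

text \<open>The linear form L of the reduction is X v; the monomial F:\<close>
definition red_mono :: "var \<Rightarrow> (nat \<Rightarrow> nat) \<Rightarrow> 'k::comm_ring_1 mpoly4" where
  "red_mono v a = (case v of
       A \<Rightarrow> X B ^ a 1 * X C ^ a 2 * X D ^ a 3
     | B \<Rightarrow> X A ^ a 1 * X C ^ a 4 * X D ^ a 5
     | C \<Rightarrow> X A ^ a 2 * X B ^ a 4 * X D ^ a 6
     | D \<Rightarrow> X A ^ a 3 * X B ^ a 5 * X C ^ a 6)"

text \<open>The curve of I: entries on the facet are replaced by max(0, a_i - 1)
  (nat subtraction truncates at 0).\<close>
definition red_curve :: "var \<Rightarrow> (nat \<Rightarrow> nat) \<Rightarrow> (nat \<Rightarrow> nat)" where
  "red_curve v a = (\<lambda>i. if i \<in> facet v then a i - 1 else a i)"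

text \<open>R/J is Cohen--Macaulay: since dim R/J = 2 for a curve, this means depth R/J >= 2,
  i.e. there is a homogeneous regular sequence f, g of positive degree on R/J.\<close>
definition ACM :: "(nat \<Rightarrow> nat) \<Rightarrow> 'k::field itself \<Rightarrow> bool" where
  "ACM a _ \<longleftrightarrow> (\<exists>f g :: 'k mpoly4. \<exists>d e :: nat. d > 0 \<and> e > 0 \<and> homog f (int d) \<and> homog g (int e) \<and>
      (\<forall>p. f * p \<in> tet_ideal a \<longrightarrow> p \<in> tet_ideal a) \<and>
      (\<forall>p. g * p \<in> ideal_gen (tet_ideal a \<union> {f}) \<longrightarrow> p \<in> ideal_gen (tet_ideal a \<union> {f})))"

definition minimal_curve :: "(nat \<Rightarrow> nat) \<Rightarrow> 'k::field itself \<Rightarrow> bool" where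
  "minimal_curve a K \<longleftrightarrow> \<not> ACM a K \<and> \<not> (\<exists>v. red_cond v a)"

text \<open>A (finite) minimal graded free resolution of the homogeneous ideal J:
  F_i = direct sum of R(-dg i j) for j < b i, the map F_i -> F_(i-1) (i >= 1) is
  given by the matrix M i (entry M i k j, k < b (i-1), j < b i), homogeneous of degree
  dg i j - dg (i-1) k, and F_0 -> J sends the j-th basis element to g j, homogeneous of
  degree dg 0 j.  Minimality: all matrix entries lie in the maximal ideal (a,b,c,d).\<close>
definition min_graded_res ::
  "'k::field mpoly4 set \<Rightarrow> (nat \<Rightarrow> nat) \<Rightarrow> (nat \<Rightarrow> nat \<Rightarrow> int) \<Rightarrow> (nat \<Rightarrow> 'k mpoly4)
     \<Rightarrow> (nat \<Rightarrow> nat \<Rightarrow> nat \<Rightarrow> 'k mpoly4) \<Rightarrow> bool" where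
  "min_graded_res J b dg g M \<longleftrightarrow>
     (\<exists>n. \<forall>i>n. b i = 0) \<and>
     J = ideal_gen {g j | j. j < b 0} \<and>
     (\<forall>j<b 0. homog (g j) (dg 0 j)) \<and>
     (\<forall>i\<ge>1. \<forall>k<b (i - 1). \<forall>j<b i. homog (M i k j) (dg i j - dg (i - 1) k)) \<and>
     (\<forall>i\<ge>1. \<forall>k<b (i - 1). \<forall>j<b i. const_coeff (M i k j) = 0) \<and>
     (\<forall>v. (\<Sum>k<b 0. v k * g k) = 0 \<longleftrightarrow>
            (\<exists>w. \<forall>k<b 0. v k = (\<Sum>j<b 1. M 1 k j * w j))) \<and>
     (\<forall>i\<ge>1. \<forall>v. (\<forall>k<b (i - 1). (\<Sum>j<b i. M i k j * v j) = 0) \<longleftrightarrow>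
            (\<exists>w. \<forall>j<b i. v j = (\<Sum>l<b (i + 1). M (i + 1) j l * w l)))"

definition linear_res :: "'k::field mpoly4 set \<Rightarrow> bool" where
  "linear_res J \<longleftrightarrow> (\<exists>b dg g M d. min_graded_res J b dg g M \<and>
      (\<forall>i. \<forall>j<b i. dg i j = d + int i))"

definition pure_res :: "'k::field mpoly4 set \<Rightarrow> bool" where
  "pure_res J \<longleftrightarrow> (\<exists>b dg g M. min_graded_res J b dg g M \<and>
      (\<forall>i. \<exists>d. \<forall>j<b i. dg i j = d))"

definition comp_linear :: "'k::field mpoly4 set \<Rightarrow> bool" where
  "comp_linear J \<longleftrightarrow> (\<forall>d::nat. linear_res (ideal_gen {p \<in> J. homog p (int d)}))"

definition min_generator :: "'k::field mpoly4 set \<Rightarrow> 'k mpoly4 \<Rightarrow> bool" where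
  "min_generator I F \<longleftrightarrow> F \<in> I \<and> F \<notin> ideal_gen {X v * h | v h. h \<in> I}"

end

theory Submission
  imports Defs
begin

text \<open>All ideals involved are monomial.  If no reduction applies, then up to a permutation
  \<open>a\<^sub>1 > a\<^sub>2 + a\<^sub>4, a\<^sub>3 + a\<^sub>5\<close> and \<open>a\<^sub>6 > a\<^sub>2 + a\<^sub>3, a\<^sub>4 + a\<^sub>5\<close>; the ideal is generated in
  degree \<open>a\<^sub>1 + a\<^sub>6\<close> by the lattice points of a rectangle with cut corners, and a suitable order of these
  shows that it has linear quotients.  Linear quotients pass from \<open>I\<close> to the product of \<open>I\<close> with the maximal ideal, which
  gives componentwise linearity.  Adding a generator \<open>f\<close> to an ideal \<open>I\<close> yields a resolution of
  \<open>I + (f)\<close> from one of \<open>I\<close> and one of \<open>I : f\<close> (a horseshoe argument on syzygies), so linear quotients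
  imply a linear resolution.  The ideal of \<open>(0,r,r,r,r,0)\<close> is \<open>(ab, cd)\<^sup>r\<close>, where the colon ideals are
  \<open>(cd)\<close>; this gives a pure resolution with quadratic syzygies.  For reductions, minimality of
  \<open>F\<close> says that \<open>F\<close> divided by any of its variables leaves \<open>I\<close>, which together with the maximality of
  the weight is a system of linear inequalities.\<close>

text \<open>All resolutions that occur have a single degree at each stage. A list of degree steps
  therefore replaces graded twists, two resolutions with the same list can be glued, and minimality
  is automatic, because entries of positive degree have no constant term. A list only bounds the
  length, since a stage may have no generators.

  The cut rectangle arises as follows. Once the degrees on a heavy pair of opposite edges
  \<open>st\<close>, \<open>uw\<close> are fixed as \<open>p\<close> and \<open>q\<close>, a
  monomial is given by its exponents at \<open>s\<close> and \<open>u\<close>, and each of the other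
  four edges cuts off one corner. The strict inequalities say that neighbouring cuts do not meet on
  their common side, so a generator blocked by one cut can still move in another direction.

  Deducing non-linearity from the pure resolution would require uniqueness of minimal resolutions.
  Instead, an arbitrary linear resolution is refuted directly, by a functional on its generators
  that detects a quadratic syzygy.\<close>

section \<open>Exponents, coefficients and homogeneous components\<close>

lemma UNIV_var: "(UNIV :: var set) = {A, B, C, D}"
  using var.exhaust by auto

instance var :: finite
  by standard (simp add: UNIV_var)

lemma mdeg_UNIV: "mdeg m = (\<Sum>v\<in>UNIV. Poly_Mapping.lookup m v)"
  unfolding mdeg_def by (rule sum.mono_neutral_left) (auto simp: in_keys_iff)

lemma mdeg_add [simp]: "mdeg (m + n) = mdeg m + mdeg n"
  by (simp add: mdeg_UNIV lookup_add sum.distrib)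

lemma mdeg_single [simp]: "mdeg (Poly_Mapping.single v n) = n"
  by (simp add: mdeg_UNIV lookup_single when_def)

lemma poly_eq_sum_single:
  "p = (\<Sum>m\<in>Poly_Mapping.keys p. Poly_Mapping.single m (Poly_Mapping.lookup p m))"
  by (rule poly_mapping_eqI)
    (auto simp: lookup_sum lookup_single when_def in_keys_iff sum.delta)

lemma homog_0 [simp]: "homog 0 e"
  by (simp add: homog_def)

lemma homog_mult: "homog p m \<Longrightarrow> homog q n \<Longrightarrow> homog (p * q) (m + n)"
  unfolding homog_def using keys_mult[of p q] by fastforce

definition hcomp :: "nat \<Rightarrow> 'k::comm_ring_1 mpoly4 \<Rightarrow> 'k mpoly4" where
  "hcomp n p = (\<Sum>m\<in>{m \<in> Poly_Mapping.keys p. mdeg m = n}.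
     Poly_Mapping.single m (Poly_Mapping.lookup p m))"

lemma lookup_hcomp:
  "Poly_Mapping.lookup (hcomp n p) m = (if mdeg m = n then Poly_Mapping.lookup p m else 0)"
  unfolding hcomp_def
  by (auto simp: lookup_sum lookup_single when_def in_keys_iff sum.delta)

lemma hcomp_0 [simp]: "hcomp n 0 = 0"
  by (rule poly_mapping_eqI) (simp add: lookup_hcomp)

lemma hcomp_add: "hcomp n (p + q) = hcomp n p + hcomp n q"
  by (rule poly_mapping_eqI) (simp add: lookup_hcomp lookup_add)

lemma hcomp_sum: "hcomp n (\<Sum>i\<in>S. f i) = (\<Sum>i\<in>S. hcomp n (f i))"
  by (induction S rule: infinite_finite_induct) (auto simp: hcomp_add)

lemma homog_hcomp: "homog (hcomp n p) (int n)"
  by (auto simp: homog_def in_keys_iff lookup_hcomp split: if_splits)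

lemma hcomp_homog: "homog p e \<Longrightarrow> hcomp n p = (if e = int n then p else 0)"
  by (rule poly_mapping_eqI) (auto simp: homog_def lookup_hcomp in_keys_iff)

text \<open>Both sides are additive in \<open>p\<close>. For a single term \<open>p\<close> the
  product is homogeneous, so each side is either the whole product or 0.\<close>

lemma hcomp_mult:
  assumes q: "homog q (int e)"
  shows "hcomp (n + e) (p * q) = hcomp n p * q"
proof -
  have s: "hcomp (n + e) (Poly_Mapping.single m c * q) = hcomp n (Poly_Mapping.single m c) * q" for m c
  proof -
    have hs: "homog (Poly_Mapping.single m c) (int (mdeg m))"
      by (auto simp: homog_def split: if_splits)
    show ?thesis
      unfolding hcomp_homog[OF homog_mult[OF hs q]] hcomp_homog[OF hs] by auto
  qed
  have "hcomp (n + e) (p * q) =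
    hcomp (n + e) (\<Sum>m\<in>Poly_Mapping.keys p. Poly_Mapping.single m (Poly_Mapping.lookup p m) * q)"
    by (subst poly_eq_sum_single[of p]) (simp add: sum_distrib_right)
  also have "\<dots> = hcomp n (\<Sum>m\<in>Poly_Mapping.keys p. Poly_Mapping.single m (Poly_Mapping.lookup p m)) * q"
    by (simp add: hcomp_sum s sum_distrib_right)
  finally show ?thesis
    by (simp flip: poly_eq_sum_single)
qed

text \<open>Of the convolution sum only the pair \<open>(m, n)\<close> survives. The two exponents
  need not be keys: if one is not, both sides are 0. This isolates coefficients in relations between
  generators.\<close>

lemma lookup_mult_unique:
  fixes p q :: "'k::comm_ring_1 mpoly4"
  assumes u: "\<And>x y. x \<in> Poly_Mapping.keys p \<Longrightarrow> y \<in> Poly_Mapping.keys q \<Longrightarrow> x + y = m + n \<Longrightarrow> x = m \<and> y = n"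
  shows "Poly_Mapping.lookup (p * q) (m + n) = Poly_Mapping.lookup p m * Poly_Mapping.lookup q n"
proof -
  let ?s = "\<lambda>p m. Poly_Mapping.single m (Poly_Mapping.lookup p m)"
  have "p * q = (\<Sum>x\<in>Poly_Mapping.keys p. \<Sum>y\<in>Poly_Mapping.keys q. ?s p x * ?s q y)"
    by (subst poly_eq_sum_single[of p], subst poly_eq_sum_single[of q]) (simp add: sum_product)
  then have "Poly_Mapping.lookup (p * q) (m + n) =
    (\<Sum>x\<in>Poly_Mapping.keys p. \<Sum>y\<in>Poly_Mapping.keys q.
      if x = m then if y = n then Poly_Mapping.lookup p m * Poly_Mapping.lookup q n else 0 else 0)"
    using u by (simp add: lookup_sum mult_single lookup_single when_def)
      (intro sum.cong refl, auto)
  also have "\<dots> = (\<Sum>x\<in>Poly_Mapping.keys p. if x = m then 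
      (\<Sum>y\<in>Poly_Mapping.keys q. if y = n then Poly_Mapping.lookup p m * Poly_Mapping.lookup q n else 0) else 0)"
    by (intro sum.cong refl) auto
  also have "\<dots> = Poly_Mapping.lookup p m * Poly_Mapping.lookup q n"
    by (auto simp: in_keys_iff)
  finally show ?thesis .
qed

lemma lookup_single_mult:
  fixes p :: "'k::comm_ring_1 mpoly4"
  shows "Poly_Mapping.lookup (Poly_Mapping.single m c * p) (m + n) = c * Poly_Mapping.lookup p n"
  by (subst lookup_mult_unique) (auto split: if_splits)

lemma keys_single_mult:
  fixes p :: "'k::comm_ring_1 mpoly4"
  shows "Poly_Mapping.keys (Poly_Mapping.single m 1 * p) = (+) m ` Poly_Mapping.keys p"
proof
  show "Poly_Mapping.keys (Poly_Mapping.single m 1 * p) \<subseteq> (+) m ` Poly_Mapping.keys p"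
    using keys_mult[of "Poly_Mapping.single m 1" p] by (auto split: if_splits)
  show "(+) m ` Poly_Mapping.keys p \<subseteq> Poly_Mapping.keys (Poly_Mapping.single m 1 * p)"
    by (auto simp: in_keys_iff lookup_single_mult)
qed

section \<open>Generated ideals\<close>

lemma ideal_gen_add:
  assumes "p \<in> ideal_gen S" "q \<in> ideal_gen S"
  shows "p + q \<in> ideal_gen S"
proof -
  obtain G c H d where G: "finite G" "G \<subseteq> S" "p = (\<Sum>g\<in>G. c g * g)"
    and H: "finite H" "H \<subseteq> S" "q = (\<Sum>g\<in>H. d g * g)"
    using assms unfolding ideal_gen_def by blast
  have "p = (\<Sum>g\<in>G \<union> H. (if g \<in> G then c g else 0) * g)"
    unfolding G(3) using G(1) H(1) by (intro sum.mono_neutral_cong_left) auto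
  moreover have "q = (\<Sum>g\<in>G \<union> H. (if g \<in> H then d g else 0) * g)"
    unfolding H(3) using G(1) H(1) by (intro sum.mono_neutral_cong_left) auto
  ultimately have "p + q = (\<Sum>g\<in>G \<union> H. ((if g \<in> G then c g else 0) + (if g \<in> H then d g else 0)) * g)"
    by (simp only: distrib_right sum.distrib)
  moreover have "finite (G \<union> H)" "G \<union> H \<subseteq> S"
    using G H by auto
  ultimately show ?thesis
    unfolding ideal_gen_def mem_Collect_eq
    by (intro exI[of _ "G \<union> H"] exI[of _ "\<lambda>g. (if g \<in> G then c g else 0) + (if g \<in> H then d g else 0)"]) simp
qed

lemma ideal_gen_mult:
  assumes "p \<in> ideal_gen S"
  shows "a * p \<in> ideal_gen S"
proof -
  obtain G c where G: "finite G" "G \<subseteq> S" "p = (\<Sum>g\<in>G. c g * g)"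
    using assms unfolding ideal_gen_def by blast
  have "a * p = (\<Sum>g\<in>G. (a * c g) * g)"
    unfolding G(3) by (simp add: sum_distrib_left mult.assoc)
  then show ?thesis
    using G unfolding ideal_gen_def by (auto intro!: exI[of _ G] exI[of _ "\<lambda>g. a * c g"])
qed

lemma ideal_gen_base: "p \<in> S \<Longrightarrow> p \<in> ideal_gen S"
  unfolding ideal_gen_def by (auto intro!: exI[of _ "{p}"] exI[of _ "\<lambda>_. 1"])

lemma ideal_gen_0: "0 \<in> ideal_gen S"
  unfolding ideal_gen_def by (auto intro!: exI[of _ "{}"])

lemma ideal_gen_sum: "(\<And>i. i \<in> I \<Longrightarrow> f i \<in> ideal_gen S) \<Longrightarrow> (\<Sum>i\<in>I. f i) \<in> ideal_gen S"
  by (induction I rule: infinite_finite_induct) (auto simp: ideal_gen_0 ideal_gen_add)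

lemma ideal_gen_least:
  assumes "S \<subseteq> I" "0 \<in> I" "\<And>p q. p \<in> I \<Longrightarrow> q \<in> I \<Longrightarrow> p + q \<in> I" "\<And>c p. p \<in> I \<Longrightarrow> c * p \<in> I"
  shows "ideal_gen S \<subseteq> I"
proof
  fix p assume "p \<in> ideal_gen S"
  then obtain G c where G: "finite G" "G \<subseteq> S" "p = (\<Sum>g\<in>G. c g * g)"
    unfolding ideal_gen_def by blast
  have "finite G \<Longrightarrow> G \<subseteq> S \<Longrightarrow> (\<Sum>g\<in>G. c g * g) \<in> I"
    by (induction G rule: finite_induct) (use assms in auto)
  then show "p \<in> I"
    using G by blast
qed

lemma ideal_gen_indexed:
  "ideal_gen {g j | j. j < (b::nat)} = {\<Sum>j<b. w j * g j | w. True}"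
proof
  show "ideal_gen {g j | j. j < b} \<subseteq> {\<Sum>j<b. w j * g j | w. True}"
  proof (rule ideal_gen_least)
    show "{g j | j. j < b} \<subseteq> {\<Sum>j<b. w j * g j | w. True}"
    proof clarify
      fix j assume "j < b"
      then have "g j = (\<Sum>i<b. (if i = j then 1 else 0) * g i)"
        by (simp add: if_distrib[where f = "\<lambda>c. c * _"] cong: if_cong)
      then show "\<exists>w. g j = (\<Sum>i<b. w i * g i) \<and> True"
        by (intro exI[of _ "\<lambda>i. if i = j then 1 else 0"]) simp
    qed
    show "0 \<in> {\<Sum>j<b. w j * g j | w. True}"
      unfolding mem_Collect_eq by (intro exI[of _ "\<lambda>_. 0"]) simp
  next
    fix p q assume "p \<in> {\<Sum>j<b. w j * g j | w. True}" "q \<in> {\<Sum>j<b. w j * g j | w. True}"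
    then obtain w w' where "p = (\<Sum>j<b. w j * g j)" "q = (\<Sum>j<b. w' j * g j)" by blast
    then have "p + q = (\<Sum>j<b. (w j + w' j) * g j)"
      by (simp add: distrib_right sum.distrib)
    then show "p + q \<in> {\<Sum>j<b. w j * g j | w. True}"
      unfolding mem_Collect_eq by (intro exI[of _ "\<lambda>j. w j + w' j"]) simp
  next
    fix c p assume "p \<in> {\<Sum>j<b. w j * g j | w. True}"
    then obtain w where "p = (\<Sum>j<b. w j * g j)" by blast
    then have "c * p = (\<Sum>j<b. (c * w j) * g j)"
      by (simp add: sum_distrib_left mult.assoc)
    then show "c * p \<in> {\<Sum>j<b. w j * g j | w. True}"
      unfolding mem_Collect_eq by (intro exI[of _ "\<lambda>j. c * w j"]) simp
  qed
  show "{\<Sum>j<b. w j * g j | w. True} \<subseteq> ideal_gen {g j | j. j < b}"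
  proof clarify
    fix w
    show "(\<Sum>j<b. w j * g j) \<in> ideal_gen {g j | j. j < b}"
      by (intro ideal_gen_sum ideal_gen_mult ideal_gen_base) auto
  qed
qed

section \<open>Monomial ideals as sets of exponents\<close>

text \<open>The set \<open>U\<close> is arbitrary here; the result is an ideal when \<open>U\<close>
  is closed under adding exponents, as \<open>upset S\<close> is.\<close>

definition mono_ideal :: "(var \<Rightarrow>\<^sub>0 nat) set \<Rightarrow> 'k::comm_ring_1 mpoly4 set" where
  "mono_ideal U = {p. Poly_Mapping.keys p \<subseteq> U}"

definition upset :: "(var \<Rightarrow>\<^sub>0 nat) set \<Rightarrow> (var \<Rightarrow>\<^sub>0 nat) set" where
  "upset S = {s + f | s f. s \<in> S}"

lemma upset_add: "m \<in> upset S \<Longrightarrow> m + f \<in> upset S"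
  unfolding upset_def by (auto simp: add.assoc) (metis)

lemma upset_base: "m \<in> S \<Longrightarrow> m \<in> upset S"
  unfolding upset_def by simp (metis add.right_neutral)

lemma upset_iff_le:
  "m \<in> upset S \<longleftrightarrow> (\<exists>s\<in>S. \<forall>v. Poly_Mapping.lookup s v \<le> Poly_Mapping.lookup m v)"
proof
  assume "\<exists>s\<in>S. \<forall>v. Poly_Mapping.lookup s v \<le> Poly_Mapping.lookup m v"
  then obtain s where s: "s \<in> S" "\<forall>v. Poly_Mapping.lookup s v \<le> Poly_Mapping.lookup m v" by blast
  have "m = s + (m - s)"
    by (rule poly_mapping_eqI) (simp add: lookup_add lookup_minus s(2))
  then show "m \<in> upset S"
    unfolding upset_def using s(1) by blast
next
  assume "m \<in> upset S"
  then obtain s f where "s \<in> S" "m = s + f"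
    unfolding upset_def by blast
  then show "\<exists>s\<in>S. \<forall>v. Poly_Mapping.lookup s v \<le> Poly_Mapping.lookup m v"
    by (intro bexI[of _ s]) (auto simp: lookup_add)
qed

lemma mono_ideal_0: "0 \<in> mono_ideal U"
  by (simp add: mono_ideal_def)

lemma mono_ideal_add: "p \<in> mono_ideal U \<Longrightarrow> q \<in> mono_ideal U \<Longrightarrow> p + q \<in> mono_ideal U"
  unfolding mono_ideal_def using keys_add[of p q] by blast

lemma mono_ideal_mult:
  assumes "p \<in> mono_ideal (upset S)"
  shows "c * p \<in> mono_ideal (upset S)"
  using assms keys_mult[of c p] upset_add unfolding mono_ideal_def
  by (smt (verit, ccfv_threshold) add.commute mem_Collect_eq subset_iff)

lemma single_in_mono_ideal: "Poly_Mapping.single m 1 \<in> (mono_ideal U :: 'k::comm_ring_1 mpoly4 set) \<longleftrightarrow> m \<in> U"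
  by (simp add: mono_ideal_def)

text \<open>\<open>G\<close> may contain polynomials that are not monomials, as happens for degree
  components and for the product with the maximal ideal. It suffices that all supports lie in
  \<open>upset S\<close> and that the monomials of \<open>S\<close> are reached.\<close>

lemma ideal_gen_eq_mono_ideal:
  fixes G :: "'k::comm_ring_1 mpoly4 set"
  assumes "G \<subseteq> mono_ideal (upset S)" "\<And>m. m \<in> S \<Longrightarrow> Poly_Mapping.single m 1 \<in> ideal_gen G"
  shows "ideal_gen G = mono_ideal (upset S)"
proof
  show "ideal_gen G \<subseteq> mono_ideal (upset S)"
    by (rule ideal_gen_least) (use assms(1) in \<open>auto intro: mono_ideal_0 mono_ideal_add mono_ideal_mult\<close>)
  show "mono_ideal (upset S) \<subseteq> ideal_gen G"
  proof
    fix p :: "'k mpoly4" assume p: "p \<in> mono_ideal (upset S)"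
    have "Poly_Mapping.single m c \<in> ideal_gen G" if m: "m \<in> Poly_Mapping.keys p" for m c
    proof -
      obtain s f where "s \<in> S" "m = s + f"
        using p m unfolding mono_ideal_def upset_def by auto
      then show ?thesis
        using ideal_gen_mult[OF assms(2), of s "Poly_Mapping.single f c"]
        by (simp add: mult_single add.commute)
    qed
    then show "p \<in> ideal_gen G"
      by (subst poly_eq_sum_single) (rule ideal_gen_sum)
  qed
qed

lemma ideal_gen_monomials:
  "ideal_gen ((\<lambda>m. Poly_Mapping.single m 1) ` S) = (mono_ideal (upset S) :: 'k::comm_ring_1 mpoly4 set)"
  by (rule ideal_gen_eq_mono_ideal)
    (auto simp: single_in_mono_ideal upset_base intro: ideal_gen_base)

section \<open>Resolutions with prescribed degrees\<close>

definition lspan :: "nat \<Rightarrow> (nat \<Rightarrow> nat \<Rightarrow> 'k::comm_ring_1 mpoly4) \<Rightarrow> (nat \<Rightarrow> 'k mpoly4) set" where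
  "lspan b h = range (\<lambda>w k. \<Sum>j<b. w j * h j k)"

text \<open>Vanishing from position \<open>b\<close> on gives every syzygy exactly one representing
  sequence, so that syzygy modules can be compared as sets.\<close>

definition syz :: "nat \<Rightarrow> (nat \<Rightarrow> nat \<Rightarrow> 'k::comm_ring_1 mpoly4) \<Rightarrow> (nat \<Rightarrow> 'k mpoly4) set" where
  "syz b h = {v. (\<forall>j\<ge>b. v j = 0) \<and> (\<forall>k. (\<Sum>j<b. v j * h j k) = 0)}"

text \<open>\<open>resolved es r N\<close>: the submodule \<open>N\<close> of \<open>R\<^sup>r\<close> has a free resolution whose successive maps are
  given by matrices with homogeneous entries of the degrees listed in \<open>es\<close>.  Elements of
  \<open>R\<^sup>r\<close> are sequences that vanish from position \<open>r\<close> on.\<close>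

fun resolved :: "nat list \<Rightarrow> nat \<Rightarrow> (nat \<Rightarrow> 'k::comm_ring_1 mpoly4) set \<Rightarrow> bool" where
  "resolved [] r N \<longleftrightarrow> N = {\<lambda>_. 0}"
| "resolved (e # es) r N \<longleftrightarrow>
     (\<exists>b h. (\<forall>j<b. \<forall>k. homog (h j k) (int e)) \<and> (\<forall>j<b. \<forall>k\<ge>r. h j k = 0) \<and>
        N = lspan b h \<and> resolved es b (syz b h))"

lemma resolved_ConsI:
  assumes "\<And>j k. j < b \<Longrightarrow> homog (h j k) (int e)" "\<And>j k. j < b \<Longrightarrow> k \<ge> r \<Longrightarrow> h j k = 0"
    "N = lspan b h" "resolved es b (syz b h)"
  shows "resolved (e # es) r N"
  unfolding resolved.simps by (intro exI[of _ b] exI[of _ h]) (use assms in auto)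

lemma resolved_ConsE:
  assumes "resolved (e # es) r N"
  obtains b h where "\<And>j k. j < b \<Longrightarrow> homog (h j k) (int e)" "\<And>j k. j < b \<Longrightarrow> k \<ge> r \<Longrightarrow> h j k = 0"
    "N = lspan b h" "resolved es b (syz b h)"
  using assms[unfolded resolved.simps] by (elim exE conjE) (rule that, auto)

text \<open>The same degree \<open>n\<close> is taken in all coordinates: the basis vectors of the
  ambient free module all have one degree.\<close>

definition graded_submodule :: "(nat \<Rightarrow> 'k::comm_ring_1 mpoly4) set \<Rightarrow> bool" where
  "graded_submodule N \<longleftrightarrow> (\<lambda>_. 0) \<in> N \<and> (\<forall>u\<in>N. \<forall>v\<in>N. (\<lambda>k. u k + v k) \<in> N) \<and>
     (\<forall>c. \<forall>v\<in>N. (\<lambda>k. c * v k) \<in> N) \<and> (\<forall>n. \<forall>v\<in>N. (\<lambda>k. hcomp n (v k)) \<in> N)"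

lemma graded_submodule_add:
  "graded_submodule N \<Longrightarrow> u \<in> N \<Longrightarrow> v \<in> N \<Longrightarrow> (\<lambda>k. u k + v k) \<in> N"
  by (simp add: graded_submodule_def)

lemma lspan_base:
  assumes "j < b"
  shows "h j \<in> lspan b h"
  unfolding lspan_def
proof (rule range_eqI)
  show "h j = (\<lambda>k. \<Sum>i<b. (if i = j then 1 else 0) * h i k)"
    using assms by (simp add: if_distrib[where f = "\<lambda>c. c * _"] cong: if_cong)
qed

lemma lspan_subset:
  assumes N: "graded_submodule N" and h: "\<And>j. j < b \<Longrightarrow> h j \<in> N"
  shows "lspan b h \<subseteq> N"
proof -
  have "(\<lambda>k. \<Sum>j<n. w j * h j k) \<in> N" if "n \<le> b" for n w
    using that
  proof (induction n)
    case 0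
    then show ?case using N by (simp add: graded_submodule_def)
  next
    case (Suc n)
    then have "(\<lambda>k. w n * h n k) \<in> N"
      using N h[of n] by (simp add: graded_submodule_def)
    then show ?case
      using N Suc unfolding graded_submodule_def
      by (simp add: graded_submodule_def) 
  qed
  then show ?thesis
    unfolding lspan_def by blast
qed

text \<open>As all entries of \<open>h\<close> have the same degree \<open>e\<close>, the degree
  \<open>n\<close> part of a syzygy produces exactly the degree \<open>n + e\<close> part of the
  relation.\<close>

lemma graded_submodule_syz:
  assumes "\<And>j k. j < b \<Longrightarrow> homog (h j k) (int e)"
  shows "graded_submodule (syz b h)"
proof -
  have "(\<Sum>j<b. hcomp n (v j) * h j k) = 0" if "(\<Sum>j<b. v j * h j k) = 0" for n v k
  proof -
    have "(\<Sum>j<b. hcomp n (v j) * h j k) = hcomp (n + e) (\<Sum>j<b. v j * h j k)"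
      using assms by (simp add: hcomp_sum hcomp_mult)
    then show ?thesis using that by simp
  qed
  moreover have "(\<Sum>j<b. c * v j * h j k) = c * (\<Sum>j<b. v j * h j k)" for c v k
    by (simp add: sum_distrib_left mult.assoc)
  ultimately show ?thesis
    unfolding graded_submodule_def syz_def
    by (simp add: distrib_right sum.distrib)
qed

text \<open>Empty families at every stage. This allows degree lists that are longer than the
  resolution itself, so that modules of different projective dimension can share a list.\<close>

lemma resolved_zero: "resolved es r {\<lambda>_. 0}"
proof (induction es arbitrary: r)
  case (Cons e es)
  have "lspan 0 (\<lambda>_ _. 0) = {\<lambda>_. 0 :: 'a mpoly4}" "syz 0 (\<lambda>_ _. 0) = {\<lambda>_. 0 :: 'a mpoly4}"
    by (auto simp: lspan_def syz_def)
  then show ?case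
    using Cons[of 0] by (auto intro!: exI[of _ 0] exI[of _ "\<lambda>_ _. 0"])
qed simp

lemma sum_lessThan_add:
  fixes f :: "nat \<Rightarrow> 'a::comm_monoid_add"
  shows "(\<Sum>j<m + n. f j) = (\<Sum>j<m. f j) + (\<Sum>j<n. f (j + m))"
  by (induction n) (auto simp: add.assoc add.commute[of m])

lemma append_families:
  fixes h' h'' :: "nat \<Rightarrow> nat \<Rightarrow> 'k::comm_ring_1 mpoly4" and m n :: nat
  defines "h \<equiv> \<lambda>j. if j < m then h' j else h'' (j - m)"
  shows "(\<Sum>j<m + n. w j * h j k) = (\<Sum>j<m. w j * h' j k) + (\<Sum>j<n. w (j + m) * h'' j k)"
  by (simp add: sum_lessThan_add h_def)

text \<open>A horseshoe lemma: the kernel and the image of the projection of \<open>N\<close> onto its last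
  \<open>s\<close> coordinates play the roles of the outer terms of a short exact sequence, and the same is
  true of the syzygies of concatenated generating families.\<close>

lemma resolved_horseshoe:
  fixes N :: "(nat \<Rightarrow> 'k::comm_ring_1 mpoly4) set"
  assumes "graded_submodule N" "\<And>v k. v \<in> N \<Longrightarrow> k \<ge> r + s \<Longrightarrow> v k = 0"
    and "resolved es r {v \<in> N. \<forall>k\<ge>r. v k = 0}"
    and "resolved es s ((\<lambda>v k. v (k + r)) ` N)"
  shows "resolved es (r + s) N"
  using assms
proof (induction es arbitrary: r s N)
  case Nil
  have "v = (\<lambda>_. 0)" if v: "v \<in> N" for v
  proof -
    have "(\<lambda>k. v (k + r)) = (\<lambda>_. 0)"
      using Nil(4) v by auto
    then have "v k = 0" if "k \<ge> r" for k
      using that by (metis le_add_diff_inverse2)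
    then show ?thesis
      using Nil(3) v by auto
  qed
  then show ?case
    using Nil(1) by (auto simp: graded_submodule_def)
next
  case (Cons e es)
  let ?N' = "{v \<in> N. \<forall>k\<ge>r. v k = 0}" and ?N'' = "(\<lambda>v k. v (k + r)) ` N"
  note N = Cons.prems(1)
  obtain m h' where h': "\<And>j k. j < m \<Longrightarrow> homog (h' j k) (int e)" "\<And>j k. j < m \<Longrightarrow> k \<ge> r \<Longrightarrow> h' j k = 0"
      "?N' = lspan m h'" "resolved es m (syz m h')"
    using Cons.prems(3) by (rule resolved_ConsE) (rule that)
  obtain n h'' where h'': "\<And>j k. j < n \<Longrightarrow> homog (h'' j k) (int e)" "\<And>j k. j < n \<Longrightarrow> k \<ge> s \<Longrightarrow> h'' j k = 0"
      "?N'' = lspan n h''" "resolved es n (syz n h'')"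
    using Cons.prems(4) by (rule resolved_ConsE) (rule that)
  \<comment> \<open>Any preimage of \<open>h'' j\<close> may be replaced by its component of degree
    \<open>e\<close>, because \<open>h'' j\<close> is homogeneous of that degree.\<close>
  have "\<exists>v\<in>N. (\<forall>k. v (k + r) = h'' j k) \<and> (\<forall>k. homog (v k) (int e))" if j: "j < n" for j
  proof -
    have "h'' j \<in> ?N''"
      unfolding h''(3) using j by (rule lspan_base)
    then obtain v where v: "v \<in> N" "h'' j = (\<lambda>k. v (k + r))" by blast
    have "(\<lambda>k. hcomp e (v k)) \<in> N"
      using N v(1) by (simp add: graded_submodule_def)
    moreover have "hcomp e (v (k + r)) = h'' j k" for k
      using h''(1)[OF j, of k] hcomp_homog[of "h'' j k" "int e" e] by (simp add: v(2))
    ultimately show ?thesis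
      by (intro bexI[of _ "\<lambda>k. hcomp e (v k)"]) (auto simp: homog_hcomp)
  qed
  then obtain l where l: "\<And>j. j < n \<Longrightarrow> l j \<in> N" "\<And>j k. j < n \<Longrightarrow> l j (k + r) = h'' j k"
      "\<And>j k. j < n \<Longrightarrow> homog (l j k) (int e)"
    by metis
  define h where "h = (\<lambda>j. if j < m then h' j else l (j - m))"
  have sum_h: "(\<Sum>j<m + n. w j * h j k) = (\<Sum>j<m. w j * h' j k) + (\<Sum>j<n. w (j + m) * l j k)" for w k
    unfolding h_def by (rule append_families)
  have hom: "homog (h j k) (int e)" if "j < m + n" for j k
    using that h'(1) l(3) by (auto simp: h_def)
  have h'N: "h' j \<in> N" if "j < m" for j
    using lspan_base[OF that, of h'] h'(3) by blast
  have hN: "h j \<in> N" if "j < m + n" for j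
    using that h'N l(1) by (auto simp: h_def)
  have lspan_l: "(\<lambda>k. \<Sum>j<n. w j * l j k) \<in> N" for w
    using lspan_subset[OF N, of n l] l(1) unfolding lspan_def by auto
  have shift_l: "(\<Sum>j<n. w j * l j (k + r)) = (\<Sum>j<n. w j * h'' j k)" for w k
    using l(2) by simp
  have N'_reduce: "\<exists>w'. \<forall>k. u k = (\<Sum>j<m. w' j * h' j k)"
    if u: "u \<in> N" "\<And>k. u (k + r) = 0" for u
  proof -
    have "u k = 0" if "k \<ge> r" for k
      using u(2)[of "k - r"] that by simp
    then have "u \<in> lspan m h'"
      using u(1) h'(3) by blast
    then show ?thesis
      unfolding lspan_def by auto
  qed
  have "N = lspan (m + n) h"
  proof
    show "lspan (m + n) h \<subseteq> N"
      using lspan_subset[OF N] hN by blast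
    show "N \<subseteq> lspan (m + n) h"
    proof
      fix v assume v: "v \<in> N"
      then have "(\<lambda>k. v (k + r)) \<in> lspan n h''"
        using h''(3) by blast
      then obtain w'' where "(\<lambda>k. v (k + r)) = (\<lambda>k. \<Sum>j<n. w'' j * h'' j k)"
        unfolding lspan_def by blast
      then have w'': "v (k + r) = (\<Sum>j<n. w'' j * h'' j k)" for k
        by (rule fun_cong)
      have "(\<lambda>k. v k + (\<Sum>j<n. (- w'' j) * l j k)) \<in> N"
        using N v lspan_l by (rule graded_submodule_add)
      moreover have "v (k + r) + (\<Sum>j<n. (- w'' j) * l j (k + r)) = 0" for k
        unfolding shift_l w'' by (simp add: sum_negf)
      ultimately obtain w' where w': "\<And>k. v k + (\<Sum>j<n. (- w'' j) * l j k) = (\<Sum>j<m. w' j * h' j k)"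
        using N'_reduce[of "\<lambda>k. v k + (\<Sum>j<n. (- w'' j) * l j k)"] by blast
      have "v = (\<lambda>k. \<Sum>j<m + n. (if j < m then w' j else w'' (j - m)) * h j k)"
        unfolding sum_h using w' by (auto simp: sum_negf algebra_simps)
      then show "v \<in> lspan (m + n) h"
        unfolding lspan_def
        by (rule range_eqI[of _ _ "\<lambda>j. if j < m then w' j else w'' (j - m)"])
    qed
  qed
  moreover have "resolved es (m + n) (syz (m + n) h)"
  proof (rule Cons.IH)
    show "graded_submodule (syz (m + n) h)"
      using hom by (rule graded_submodule_syz)
    show "v k = 0" if "v \<in> syz (m + n) h" "k \<ge> m + n" for v k
      using that by (simp add: syz_def)
    have "{v \<in> syz (m + n) h. \<forall>k\<ge>m. v k = 0} = syz m h'"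
      by (auto simp: syz_def sum_h)
    then show "resolved es m {v \<in> syz (m + n) h. \<forall>k\<ge>m. v k = 0}"
      using h'(4) by simp
    have "(\<lambda>v k. v (k + m)) ` syz (m + n) h = syz n h''"
    proof
      show "(\<lambda>v k. v (k + m)) ` syz (m + n) h \<subseteq> syz n h''"
      proof clarify
        fix v assume v: "v \<in> syz (m + n) h"
        have "(\<Sum>j<n. v (j + m) * h'' j k) = (\<Sum>j<m + n. v j * h j (k + r))" for k
          unfolding sum_h shift_l using h'(2) by simp
        then show "(\<lambda>k. v (k + m)) \<in> syz n h''"
          using v by (simp add: syz_def)
      qed
      show "syz n h'' \<subseteq> (\<lambda>v k. v (k + m)) ` syz (m + n) h"
      proof
        fix u assume u: "u \<in> syz n h''"
        \<comment> \<open>The lifts \<open>l\<close> need not satisfy the relation \<open>u\<close>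
          themselves, but the error projects to 0 and is absorbed by the family
          \<open>h'\<close>.\<close>
        have "(\<Sum>j<n. u j * l j (k + r)) = 0" for k
          unfolding shift_l using u by (simp add: syz_def)
        then obtain w' where w': "\<And>k. (\<Sum>j<n. u j * l j k) = (\<Sum>j<m. w' j * h' j k)"
          using N'_reduce[OF lspan_l] by blast
        let ?v = "\<lambda>j. if j < m then - w' j else u (j - m)"
        have "?v \<in> syz (m + n) h"
          using u unfolding syz_def by (auto simp: sum_h w' sum_negf)
        moreover have "u = (\<lambda>k. ?v (k + m))"
          by auto
        ultimately show "u \<in> (\<lambda>v k. v (k + m)) ` syz (m + n) h"
          by (intro image_eqI[of _ _ ?v])
      qed
    qed
    then show "resolved es n ((\<lambda>v k. v (k + m)) ` syz (m + n) h)"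
      using h''(4) by simp
  qed
  moreover have "h j k = 0" if "j < m + n" "k \<ge> r + s" for j k
    using Cons.prems(2) hN that by blast
  ultimately show ?case
    using hom by (intro resolved_ConsI)
qed

definition vec1 :: "'k::comm_ring_1 mpoly4 \<Rightarrow> nat \<Rightarrow> 'k mpoly4" where
  "vec1 p = (\<lambda>k. if k = 0 then p else 0)"

text \<open>The relations among the generators of \<open>I\<close> and \<open>f\<close> whose last
  coefficient vanishes are the syzygies of \<open>I\<close>, and the last coefficients of all
  relations form \<open>I : f\<close>. Both have resolutions with list \<open>es\<close>, so the
  horseshoe applies to the syzygy module.\<close>

lemma resolved_add_generator:
  fixes I :: "'k::comm_ring_1 mpoly4 set"
  assumes I: "resolved (d # es) 1 (vec1 ` I)" and f: "homog f (int d)"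
    and colon: "resolved es 1 (vec1 ` {p. p * f \<in> I})"
  shows "resolved (d # es) 1 (vec1 ` {p + q * f | p q. p \<in> I})"
proof -
  obtain b h where h: "\<And>j k. j < b \<Longrightarrow> homog (h j k) (int d)" "\<And>j k. j < b \<Longrightarrow> k \<ge> 1 \<Longrightarrow> h j k = 0"
      "vec1 ` I = lspan b h" "resolved es b (syz b h)"
    using I by (rule resolved_ConsE) (rule that)
  have I_iff: "p \<in> I \<longleftrightarrow> (\<exists>w. p = (\<Sum>j<b. w j * h j 0))" for p
  proof
    assume "p \<in> I"
    then have "vec1 p \<in> lspan b h" using h(3) by blast
    then obtain w where "vec1 p = (\<lambda>k. \<Sum>j<b. w j * h j k)" unfolding lspan_def by blast
    then have "vec1 p 0 = (\<Sum>j<b. w j * h j 0)" by (rule fun_cong)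
    then show "\<exists>w. p = (\<Sum>j<b. w j * h j 0)" by (auto simp: vec1_def)
  next
    assume "\<exists>w. p = (\<Sum>j<b. w j * h j 0)"
    then obtain w where w: "p = (\<Sum>j<b. w j * h j 0)" by blast
    have "(\<lambda>k. \<Sum>j<b. w j * h j k) \<in> vec1 ` I" unfolding h(3) lspan_def by blast
    then obtain p' where p': "p' \<in> I" "(\<lambda>k. \<Sum>j<b. w j * h j k) = vec1 p'" by blast
    have "p = p'" using fun_cong[OF p'(2), of 0] w by (simp add: vec1_def)
    then show "p \<in> I" using p'(1) by simp
  qed
  define g where "g = (\<lambda>j. if j < b then h j else (\<lambda>i. vec1 f) (j - b))"
  have sum_g: "(\<Sum>j<b + 1. w j * g j k) = (\<Sum>j<b. w j * h j k) + w b * vec1 f k" for w k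
    unfolding g_def by (subst append_families) simp
  have sum_h: "(\<Sum>j<b. w j * h j k) = 0" if "k \<noteq> 0" for w k
    using h(2)[of _ k] that by simp
  have hom: "homog (g j k) (int d)" if "j < b + 1" for j k
    using that f h(1) by (auto simp: g_def vec1_def)
  have "resolved es (b + 1) (syz (b + 1) g)"
  proof (rule resolved_horseshoe)
    show "graded_submodule (syz (b + 1) g)"
      using hom by (rule graded_submodule_syz)
    show "v k = 0" if "v \<in> syz (b + 1) g" "k \<ge> b + 1" for v k
      using that by (simp add: syz_def)
    have "{v \<in> syz (b + 1) g. \<forall>k\<ge>b. v k = 0} = syz b h"
      unfolding syz_def sum_g by auto
    then show "resolved es b {v \<in> syz (b + 1) g. \<forall>k\<ge>b. v k = 0}"
      using h(4) by simp
    have "(\<lambda>v k. v (k + b)) ` syz (b + 1) g = vec1 ` {p. p * f \<in> I}"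
    proof
      show "(\<lambda>v k. v (k + b)) ` syz (b + 1) g \<subseteq> vec1 ` {p. p * f \<in> I}"
      proof clarify
        fix v assume v: "v \<in> syz (b + 1) g"
        then have "(\<Sum>j<b. v j * h j 0) + v b * f = 0"
          unfolding syz_def sum_g by (auto simp: vec1_def dest: spec[of _ 0])
        then have "v b * f = (\<Sum>j<b. (- v j) * h j 0)"
          by (simp add: sum_negf eq_neg_iff_add_eq_0 add.commute)
        then have "v b * f \<in> I"
          unfolding I_iff by (rule exI[of _ "\<lambda>j. - v j"])
        moreover have "(\<lambda>k. v (k + b)) = vec1 (v b)"
          using v by (auto simp: syz_def vec1_def)
        ultimately show "(\<lambda>k. v (k + b)) \<in> vec1 ` {p. p * f \<in> I}"
          by simp
      qed
      show "vec1 ` {p. p * f \<in> I} \<subseteq> (\<lambda>v k. v (k + b)) ` syz (b + 1) g"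
      proof clarify
        fix p assume "p * f \<in> I"
        then obtain w where w: "p * f = (\<Sum>j<b. w j * h j 0)"
          unfolding I_iff by blast
        define v where "v = (\<lambda>j. if j < b then - w j else vec1 p (j - b))"
        have "v \<in> syz (b + 1) g"
          unfolding syz_def sum_g using w
          by (auto simp: v_def sum_negf vec1_def sum_h)
        moreover have "vec1 p = (\<lambda>k. v (k + b))"
          by (auto simp: v_def)
        ultimately show "vec1 p \<in> (\<lambda>v k. v (k + b)) ` syz (b + 1) g"
          by blast
      qed
    qed
    then show "resolved es 1 ((\<lambda>v k. v (k + b)) ` syz (b + 1) g)"
      using colon by simp
  qed
  moreover have "vec1 ` {p + q * f | p q. p \<in> I} = lspan (b + 1) g"
  proof
    show "vec1 ` {p + q * f | p q. p \<in> I} \<subseteq> lspan (b + 1) g"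
    proof clarify
      fix p q assume "p \<in> I"
      then obtain w where w: "p = (\<Sum>j<b. w j * h j 0)"
        unfolding I_iff by blast
      show "vec1 (p + q * f) \<in> lspan (b + 1) g"
        unfolding lspan_def
      proof (rule range_eqI)
        show "vec1 (p + q * f) = (\<lambda>k. \<Sum>j<b + 1. (if j < b then w j else q) * g j k)"
          unfolding sum_g using w by (auto simp: vec1_def sum_h)
      qed
    qed
    show "lspan (b + 1) g \<subseteq> vec1 ` {p + q * f | p q. p \<in> I}"
    proof
      fix v assume "v \<in> lspan (b + 1) g"
      then obtain w where w: "v = (\<lambda>k. (\<Sum>j<b. w j * h j k) + w b * vec1 f k)"
        unfolding lspan_def sum_g by blast
      have "v = vec1 ((\<Sum>j<b. w j * h j 0) + w b * f)"
        unfolding w by (auto simp: vec1_def sum_h)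
      moreover have "(\<Sum>j<b. w j * h j 0) \<in> I"
        unfolding I_iff by blast
      ultimately show "v \<in> vec1 ` {p + q * f | p q. p \<in> I}"
        by blast
    qed
  qed
  moreover have "g j k = 0" if "j < b + 1" "k \<ge> 1" for j k
    using that h(2) by (auto simp: g_def vec1_def)
  ultimately show ?thesis
    using hom by (intro resolved_ConsI)
qed

text \<open>Unrolls the recursion into one sequence of matrices with \<open>b 0 = r\<close>. Rows
  become columns (\<open>M 1 k j\<close> is \<open>h j k\<close>), and vectors count only up to
  their length, whereas \<open>syz\<close> insists on zeros beyond it.\<close>

lemma resolved_imp_matrices:
  fixes N :: "(nat \<Rightarrow> 'k::comm_ring_1 mpoly4) set"
  assumes "resolved es r N"
  shows "\<exists>b M. b 0 = r \<and> (\<forall>i>length es. b i = 0) \<and>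
    (\<forall>i<length es. \<forall>k<b i. \<forall>j<b (Suc i). homog (M (Suc i) k j) (int (es ! i))) \<and>
    (\<forall>v. (\<forall>k\<ge>r. v k = 0) \<longrightarrow> (v \<in> N \<longleftrightarrow> (\<exists>w. \<forall>k<r. v k = (\<Sum>j<b 1. M 1 k j * w j)))) \<and>
    (\<forall>i\<ge>1. \<forall>v. (\<forall>k<b (i - 1). (\<Sum>j<b i. M i k j * v j) = 0) \<longleftrightarrow>
       (\<exists>w. \<forall>j<b i. v j = (\<Sum>l<b (i + 1). M (i + 1) j l * w l)))"
  using assms
proof (induction es arbitrary: r N)
  case Nil
  show ?case
  proof (intro exI[of _ "\<lambda>i. if i = 0 then r else 0"] exI[of _ "\<lambda>_ _ _. 0"] conjI allI impI)
    fix v :: "nat \<Rightarrow> 'k mpoly4" assume v: "\<forall>k\<ge>r. v k = 0"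
    have "v \<in> N \<longleftrightarrow> (\<forall>k<r. v k = 0)"
      using Nil v by (auto simp: fun_eq_iff) (meson not_less)
    then show "v \<in> N \<longleftrightarrow>
        (\<exists>w. \<forall>k<r. v k = (\<Sum>j<(if (1::nat) = 0 then r else 0). 0 * w j))"
      by simp
  qed auto
next
  case (Cons e es)
  obtain m h where h: "\<And>j k. j < m \<Longrightarrow> homog (h j k) (int e)" "\<And>j k. j < m \<Longrightarrow> k \<ge> r \<Longrightarrow> h j k = 0"
      "N = lspan m h" "resolved es m (syz m h)"
    using Cons.prems by (rule resolved_ConsE) (rule that)
  obtain b M where b0: "b 0 = m" and bi: "\<forall>i>length es. b i = 0"
    and hom: "\<forall>i<length es. \<forall>k<b i. \<forall>j<b (Suc i). homog (M (Suc i) k j) (int (es ! i))"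
    and sz: "\<forall>v. (\<forall>k\<ge>m. v k = 0) \<longrightarrow>
      (v \<in> syz m h \<longleftrightarrow> (\<exists>w. \<forall>k<m. v k = (\<Sum>j<b 1. M 1 k j * w j)))"
    and ex: "\<forall>i\<ge>1. \<forall>v. (\<forall>k<b (i - 1). (\<Sum>j<b i. M i k j * v j) = 0) \<longleftrightarrow>
       (\<exists>w. \<forall>j<b i. v j = (\<Sum>l<b (i + 1). M (i + 1) j l * w l))"
    using Cons.IH[OF h(4)] by (elim exE conjE) (rule that; assumption)
  define b' where "b' = (\<lambda>i. case i of 0 \<Rightarrow> r | Suc i \<Rightarrow> b i)"
  \<comment> \<open>Matrices are numbered from 1; the value at 0 is a filler.\<close>
  define M' where "M' = (\<lambda>i. case i of 0 \<Rightarrow> (\<lambda>_ _. 0) | Suc 0 \<Rightarrow> (\<lambda>k j. h j k) | Suc (Suc i) \<Rightarrow> M (Suc i))"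
  have b'_simps [simp]: "b' 0 = r" "b' (Suc i) = b i" for i
    by (simp_all add: b'_def)
  have M'_simps [simp]: "M' (Suc 0) k j = h j k" "M' (Suc (Suc i)) = M (Suc i)" for i k j
    by (simp_all add: M'_def)
  show ?case
  proof (intro exI[of _ b'] exI[of _ M'] conjI allI impI)
    show "b' i = 0" if "length (e # es) < i" for i
      using that bi by (cases i) auto
    show "homog (M' (Suc i) k j) (int ((e # es) ! i))"
      if "i < length (e # es)" "k < b' i" "j < b' (Suc i)" for i k j
      using that h(1) hom b0 by (cases i) auto
    show "v \<in> N \<longleftrightarrow> (\<exists>w. \<forall>k<r. v k = (\<Sum>j<b' 1. M' 1 k j * w j))" if v: "\<forall>k\<ge>r. v k = 0" for v
    proof
      assume "v \<in> N"
      then obtain w where "v = (\<lambda>k. \<Sum>j<m. w j * h j k)"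
        unfolding h(3) lspan_def by blast
      then show "\<exists>w. \<forall>k<r. v k = (\<Sum>j<b' 1. M' 1 k j * w j)"
        by (intro exI[of _ w]) (simp add: b0 mult.commute)
    next
      assume "\<exists>w. \<forall>k<r. v k = (\<Sum>j<b' 1. M' 1 k j * w j)"
      then obtain w where w: "\<And>k. k < r \<Longrightarrow> v k = (\<Sum>j<m. w j * h j k)"
        by (auto simp: b0 mult.commute)
      have "v k = (\<Sum>j<m. w j * h j k)" for k
        using w v h(2) by (cases "k < r") auto
      then show "v \<in> N"
        unfolding h(3) lspan_def by blast
    qed
    show "(\<forall>k<b' (i - 1). (\<Sum>j<b' i. M' i k j * v j) = 0) \<longleftrightarrow>
       (\<exists>w. \<forall>j<b' i. v j = (\<Sum>l<b' (i + 1). M' (i + 1) j l * w l))" if "i \<ge> 1" for i v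
    proof (cases "i = 1")
      case True
      \<comment> \<open>Cutting \<open>v\<close> off at \<open>m\<close> turns it into a candidate
        for \<open>syz m h\<close> without changing the sums.\<close>
      define u where "u = (\<lambda>j. if j < m then v j else 0)"
      have "(\<forall>k<r. (\<Sum>j<m. h j k * v j) = 0) \<longleftrightarrow> u \<in> syz m h"
      proof -
        have "(\<Sum>j<m. u j * h j k) = (\<Sum>j<m. h j k * v j)" for k
          by (simp add: u_def mult.commute)
        moreover have "(\<Sum>j<m. h j k * v j) = 0" if "k \<ge> r" for k
          using h(2) that by simp
        ultimately show ?thesis
          unfolding syz_def by (auto simp: u_def) (meson not_less)
      qed
      moreover have "u \<in> syz m h \<longleftrightarrow> (\<exists>w. \<forall>k<m. u k = (\<Sum>j<b 1. M 1 k j * w j))"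
        by (rule sz[rule_format]) (simp add: u_def)
      ultimately show ?thesis
        by (simp add: True b0 u_def)
    next
      case False
      define i' where "i' = i - 2"
      have i: "i = Suc (Suc i')"
        using that False by (simp add: i'_def)
      show ?thesis
        unfolding i using ex[rule_format, of "Suc i'" v] by simp
    qed
  qed simp
qed

text \<open>Positive degree steps give minimality, since homogeneous entries of positive degree have
  no constant coefficient. The degree at stage \<open>i\<close> is the partial sum of the
  list.\<close>

lemma resolved_imp_min_graded_res:
  fixes J :: "'k::field mpoly4 set"
  assumes res: "resolved (d # es) 1 (vec1 ` J)" and pos: "\<And>e. e \<in> set es \<Longrightarrow> e > 0"
  shows "\<exists>b g M. min_graded_res J b (\<lambda>i j. int d + int (sum_list (take i es))) g M \<and>
    (\<forall>i>length es. b i = 0)"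
proof -
  obtain m h where h: "\<And>j k. j < m \<Longrightarrow> homog (h j k) (int d)" "\<And>j k. j < m \<Longrightarrow> k \<ge> 1 \<Longrightarrow> h j k = 0"
      "vec1 ` J = lspan m h" "resolved es m (syz m h)"
    using res by (rule resolved_ConsE) (rule that)
  obtain b M where b0: "b 0 = m" and bi: "\<forall>i>length es. b i = 0"
    and hom: "\<forall>i<length es. \<forall>k<b i. \<forall>j<b (Suc i). homog (M (Suc i) k j) (int (es ! i))"
    and sz: "\<forall>v. (\<forall>k\<ge>m. v k = 0) \<longrightarrow>
      (v \<in> syz m h \<longleftrightarrow> (\<exists>w. \<forall>k<m. v k = (\<Sum>j<b 1. M 1 k j * w j)))"
    and ex: "\<forall>i\<ge>1. \<forall>v. (\<forall>k<b (i - 1). (\<Sum>j<b i. M i k j * v j) = 0) \<longleftrightarrow>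
       (\<exists>w. \<forall>j<b i. v j = (\<Sum>l<b (i + 1). M (i + 1) j l * w l))"
    using resolved_imp_matrices[OF h(4)] by (elim exE conjE) (rule that; assumption)
  have f1: "J = ideal_gen {h j 0 | j. j < m}"
  proof -
    have "J = (\<lambda>v. v 0) ` (vec1 ` J)"
      by (simp add: image_image vec1_def)
    also have "\<dots> = ideal_gen {h j 0 | j. j < m}"
      unfolding h(3) ideal_gen_indexed lspan_def by auto
    finally show ?thesis .
  qed
  have hM: "homog (M i k j) (int (es ! (i - 1))) \<and> i - 1 < length es"
    if "i \<ge> 1" "k < b (i - 1)" "j < b i" for i k j
  proof -
    have "\<not> length es < i"
      using that(3) bi by force
    then show ?thesis
      using hom[rule_format, of "i - 1" k j] that by simp
  qed
  have f2: "homog (M i k j) (int d + int (sum_list (take i es)) - (int d + int (sum_list (take (i - 1) es))))"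
    if "i \<ge> 1" "k < b (i - 1)" "j < b i" for i k j
    using hM[OF that] that(1) take_Suc_conv_app_nth[of "i - 1" es] by simp
  have f3: "const_coeff (M i k j) = 0" if "i \<ge> 1" "k < b (i - 1)" "j < b i" for i k j
  proof -
    have "es ! (i - 1) > 0"
      using hM[OF that] pos by simp
    then have "0 \<notin> Poly_Mapping.keys (M i k j)"
      using hM[OF that] by (auto simp: homog_def mdeg_def)
    then show ?thesis
      by (simp add: const_coeff_def in_keys_iff)
  qed
  have f4: "(\<Sum>k<m. v k * h k 0) = 0 \<longleftrightarrow> (\<exists>w. \<forall>k<m. v k = (\<Sum>j<b 1. M 1 k j * w j))" for v
  proof -
    define u where "u = (\<lambda>j. if j < m then v j else 0)"
    have *: "(\<Sum>j<m. v j * h j k) = 0" if "k \<noteq> 0" for k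
      using h(2)[of _ k] that by simp
    have "(\<Sum>k<m. v k * h k 0) = 0 \<longleftrightarrow> u \<in> syz m h"
    proof -
      define S where "S = (\<lambda>k. \<Sum>j<m. v j * h j k)"
      have S: "(\<Sum>j<m. u j * h j k) = S k" for k
        by (simp add: u_def S_def)
      have "u \<in> syz m h \<longleftrightarrow> (\<forall>k. S k = 0)"
        unfolding syz_def S by (simp add: u_def S_def)
      moreover have "(\<forall>k. S k = 0) \<longleftrightarrow> S 0 = 0"
        using * unfolding S_def by (metis (no_types))
      ultimately show ?thesis
        by (simp add: S_def)
    qed
    moreover have "u \<in> syz m h \<longleftrightarrow> (\<exists>w. \<forall>k<m. u k = (\<Sum>j<b 1. M 1 k j * w j))"
      by (rule sz[rule_format]) (simp add: u_def)
    ultimately show ?thesis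
      by (simp add: u_def)
  qed
  have "min_graded_res J b (\<lambda>i j. int d + int (sum_list (take i es))) (\<lambda>j. h j 0) M"
    unfolding min_graded_res_def
  proof (intro conjI allI impI)
    show "\<exists>n. \<forall>i>n. b i = 0" using bi by blast
    show "J = ideal_gen {h j 0 |j. j < b 0}" using f1 b0 by simp
    show "homog (h j 0) (int d + int (sum_list (take 0 es)))" if "j < b 0" for j
      using that h(1) b0 by simp
    show "homog (M i k j) (int d + int (sum_list (take i es)) - (int d + int (sum_list (take (i - 1) es))))"
      if "i \<ge> 1" "k < b (i - 1)" "j < b i" for i k j
      using that by (rule f2)
    show "const_coeff (M i k j) = 0" if "i \<ge> 1" "k < b (i - 1)" "j < b i" for i k j
      using that by (rule f3)
    show "(\<Sum>k<b 0. v k * h k 0) = 0 \<longleftrightarrow> (\<exists>w. \<forall>k<b 0. v k = (\<Sum>j<b 1. M 1 k j * w j))" for v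
      unfolding b0 by (rule f4)
    show "(\<forall>k<b (i - 1). (\<Sum>j<b i. M i k j * v j) = 0) \<longleftrightarrow>
       (\<exists>w. \<forall>j<b i. v j = (\<Sum>l<b (i + 1). M (i + 1) j l * w l))" if "i \<ge> 1" for i v
      using that ex by simp
  qed
  then show ?thesis
    using bi by blast
qed

lemma resolved_imp_linear_res:
  assumes "resolved (d # replicate n 1) 1 (vec1 ` J)"
  shows "linear_res (J :: 'k::field mpoly4 set)"
proof -
  obtain b g M where *: "min_graded_res J b (\<lambda>i j. int d + int (sum_list (take i (replicate n 1)))) g M"
    "\<And>i. i > n \<Longrightarrow> b i = 0"
    using resolved_imp_min_graded_res[OF assms] by auto
  \<comment> \<open>The partial sums stop growing at \<open>n\<close>, where the resolution has
    ended.\<close>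
  have "int d + int (sum_list (take i (replicate n 1))) = int d + int i" if "j < b i" for i j
  proof -
    have "i \<le> n"
      using that *(2)[of i] by (cases "i \<le> n") auto
    then show ?thesis
      by (simp add: sum_list_replicate)
  qed
  then show ?thesis
    unfolding linear_res_def using *(1) by blast
qed

section \<open>Linear quotients\<close>

lemma split_off_variable:
  assumes "Poly_Mapping.lookup (f :: var \<Rightarrow>\<^sub>0 nat) v \<noteq> 0"
  obtains g where "f = Poly_Mapping.single v 1 + g"
proof
  show "f = Poly_Mapping.single v 1 + (f - Poly_Mapping.single v 1)"
    using assms by (intro poly_mapping_eqI) (auto simp: lookup_add lookup_minus lookup_single when_def)
qed

lemma in_range_single_add:
  "f \<in> range ((+) (Poly_Mapping.single v 1)) \<longleftrightarrow> Poly_Mapping.lookup (f :: var \<Rightarrow>\<^sub>0 nat) v \<noteq> 0"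
proof
  assume "Poly_Mapping.lookup f v \<noteq> 0"
  then obtain g where "f = Poly_Mapping.single v 1 + g"
    by (rule split_off_variable)
  then show "f \<in> range ((+) (Poly_Mapping.single v 1))"
    by (rule range_eqI)
qed (auto simp: lookup_add)

lemma mono_ideal_Un_principal:
  fixes m :: "var \<Rightarrow>\<^sub>0 nat"
  shows "(mono_ideal (U \<union> range ((+) m)) :: 'k::comm_ring_1 mpoly4 set) =
    {p + q * Poly_Mapping.single m 1 | p q. p \<in> mono_ideal U}"
proof
  show "mono_ideal (U \<union> range ((+) m)) \<subseteq> {p + q * Poly_Mapping.single m 1 | p q. p \<in> (mono_ideal U :: 'k mpoly4 set)}"
  proof
    fix r :: "'k mpoly4" assume r: "r \<in> mono_ideal (U \<union> range ((+) m))"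
    let ?s = "\<lambda>k. Poly_Mapping.single k (Poly_Mapping.lookup r k)"
    let ?p = "\<Sum>k\<in>Poly_Mapping.keys r \<inter> U. ?s k"
    \<comment> \<open>Exponents of \<open>r\<close> outside \<open>U\<close> are multiples of
      \<open>m\<close>, so the truncated difference \<open>k - m\<close> is an exact
      quotient.\<close>
    let ?q = "\<Sum>k\<in>Poly_Mapping.keys r - U. Poly_Mapping.single (k - m) (Poly_Mapping.lookup r k)"
    have "?q * Poly_Mapping.single m 1 = (\<Sum>k\<in>Poly_Mapping.keys r - U. ?s k)"
      unfolding sum_distrib_right
    proof (rule sum.cong)
      fix k assume "k \<in> Poly_Mapping.keys r - U"
      then obtain f where "k = m + f"
        using r unfolding mono_ideal_def by blast
      then show "Poly_Mapping.single (k - m) (Poly_Mapping.lookup r k) * Poly_Mapping.single m 1 = ?s k"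
        by (simp add: mult_single add.commute)
    qed simp
    then have "r = ?p + ?q * Poly_Mapping.single m 1"
      using poly_eq_sum_single[of r] sum.Int_Diff[of "Poly_Mapping.keys r" ?s U] by simp
    moreover have "?p \<in> mono_ideal U"
      by (auto simp: mono_ideal_def in_keys_iff lookup_sum lookup_single when_def sum.delta split: if_splits)
    ultimately show "r \<in> {p + q * Poly_Mapping.single m 1 | p q. p \<in> (mono_ideal U :: 'k mpoly4 set)}"
      by blast
  qed
  show "{p + q * Poly_Mapping.single m 1 | p q. p \<in> (mono_ideal U :: 'k mpoly4 set)} \<subseteq> mono_ideal (U \<union> range ((+) m))"
  proof clarify
    fix p q :: "'k mpoly4" assume "p \<in> mono_ideal U"
    moreover have "Poly_Mapping.keys (q * Poly_Mapping.single m 1) \<subseteq> range ((+) m)"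
      unfolding mult.commute[of q] keys_single_mult by blast
    ultimately show "p + q * Poly_Mapping.single m 1 \<in> mono_ideal (U \<union> range ((+) m))"
      by (intro mono_ideal_add) (auto simp: mono_ideal_def)
  qed
qed

lemma resolved_add_monomial:
  assumes "resolved (d # es) 1 (vec1 ` (mono_ideal U :: 'k::comm_ring_1 mpoly4 set))" "mdeg m = d"
    and colon: "resolved es 1 (vec1 ` (mono_ideal {f. m + f \<in> U} :: 'k mpoly4 set))"
  shows "resolved (d # es) 1 (vec1 ` (mono_ideal (U \<union> range ((+) m)) :: 'k mpoly4 set))"
  unfolding mono_ideal_Un_principal
proof (rule resolved_add_generator)
  show "homog (Poly_Mapping.single m (1 :: 'k)) (int d)"
    using assms(2) by (simp add: homog_def)
  have "{p. p * Poly_Mapping.single m 1 \<in> (mono_ideal U :: 'k mpoly4 set)} = mono_ideal {f. m + f \<in> U}"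
    by (auto simp: mono_ideal_def mult.commute[of _ "Poly_Mapping.single m 1"] keys_single_mult)
  then show "resolved es 1 (vec1 ` {p. p * Poly_Mapping.single m 1 \<in> (mono_ideal U :: 'k mpoly4 set)})"
    using colon by simp
qed (rule assms(1))

lemma mono_ideal_empty: "mono_ideal {} = {0}"
  by (auto simp: mono_ideal_def)

lemma vec1_0: "vec1 0 = (\<lambda>_. 0)"
  by (auto simp: vec1_def)

text \<open>The exponents of the ideal generated by the variables in \<open>V\<close>.\<close>

definition meets :: "var set \<Rightarrow> (var \<Rightarrow>\<^sub>0 nat) set" where
  "meets V = {f. \<exists>v\<in>V. Poly_Mapping.lookup f v \<noteq> 0}"

text \<open>The Koszul resolution, one variable at a time: a new variable is a nonzerodivisor modulo
  the others, so the colon ideal is again \<open>meets V\<close>.\<close>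

lemma resolved_variables:
  assumes "finite V" "card V \<le> n"
  shows "resolved (replicate n 1) 1 (vec1 ` (mono_ideal (meets V) :: 'k::comm_ring_1 mpoly4 set))"
  using assms
proof (induction V arbitrary: n rule: finite_induct)
  case empty
  then show ?case
    by (simp add: meets_def mono_ideal_empty vec1_0 resolved_zero)
next
  case (insert x V)
  then obtain n' where n: "n = Suc n'" "card V \<le> n'"
    by (cases n) auto
  have "meets (insert x V) = meets V \<union> range ((+) (Poly_Mapping.single x 1))"
    unfolding meets_def set_eq_iff Un_iff in_range_single_add by blast
  moreover have "{f. Poly_Mapping.single x 1 + f \<in> meets V} = meets V"
    using insert.hyps(2) unfolding meets_def by (auto simp: lookup_add lookup_single when_def)
  moreover have "resolved (1 # replicate n' 1) 1 (vec1 ` (mono_ideal (meets V) :: 'k mpoly4 set))"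
    using insert.IH[of n] n by simp
  moreover have "resolved (replicate n' 1) 1 (vec1 ` (mono_ideal (meets V) :: 'k mpoly4 set))"
    using insert.IH[of n'] n by simp
  ultimately show ?case
    using resolved_add_monomial[of 1 "replicate n' 1" "meets V" "Poly_Mapping.single x 1"]
    by (simp add: n)
qed

lemma meets_iff_split: "f \<in> meets V \<longleftrightarrow> (\<exists>v\<in>V. \<exists>g. f = Poly_Mapping.single v 1 + g)"
  unfolding meets_def mem_Collect_eq in_range_single_add[symmetric] by blast

text \<open>The order of the generators is recorded by the derivation. Since 0 lies in no
  \<open>meets V\<close>, a new generator \<open>m\<close> never belongs to \<open>U\<close>
  already.\<close>

inductive linear_quotients :: "nat \<Rightarrow> (var \<Rightarrow>\<^sub>0 nat) set \<Rightarrow> bool" for d where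
  empty: "linear_quotients d {}"
| add: "linear_quotients d U \<Longrightarrow> mdeg m = d \<Longrightarrow> {f. m + f \<in> U} = meets V \<Longrightarrow>
    linear_quotients d (U \<union> range ((+) m))"

text \<open>The four entries 1 accommodate the Koszul resolution of any colon ideal, as there are
  four variables.\<close>

lemma linear_quotients_resolved:
  assumes "linear_quotients d U"
  shows "resolved (d # replicate 4 1) 1 (vec1 ` (mono_ideal U :: 'k::comm_ring_1 mpoly4 set))"
  using assms
proof induction
  case empty
  then show ?case
    using resolved_zero[of "d # replicate 4 1"] by (simp add: mono_ideal_empty vec1_0 del: resolved.simps)
next
  case (add U m V)
  have "card V \<le> 4"
    using card_mono[of UNIV V, OF finite subset_UNIV] by (simp add: UNIV_var)
  then show ?case
    using add resolved_variables[of V 4] by (intro resolved_add_monomial) auto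
qed

lemma linear_quotients_add_closed:
  "linear_quotients d U \<Longrightarrow> m \<in> U \<Longrightarrow> m + f \<in> U"
  by (induction rule: linear_quotients.induct) (auto simp: add.assoc)

lemma linear_quotients_generated:
  "linear_quotients d U \<Longrightarrow> k \<in> U \<Longrightarrow> \<exists>m f. k = m + f \<and> m \<in> U \<and> mdeg m = d"
proof (induction rule: linear_quotients.induct)
  case (add U m V)
  have "m \<in> range ((+) m)"
    by (metis add.right_neutral rangeI)
  then show ?case
    using add by blast
qed simp

definition var_mult :: "(var \<Rightarrow>\<^sub>0 nat) set \<Rightarrow> (var \<Rightarrow>\<^sub>0 nat) set" where
  "var_mult U = {Poly_Mapping.single v 1 + f | v f. f \<in> U}"

lemma linear_quotients_in_var_mult:
  assumes U: "linear_quotients d U" and k: "k \<in> U" "mdeg k > d"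
  shows "k \<in> var_mult U"
proof -
  obtain m f where mf: "k = m + f" "m \<in> U" "mdeg m = d"
    using linear_quotients_generated[OF U k(1)] by blast
  then have "f \<noteq> 0"
    using k(2) by (auto simp: mdeg_def)
  then obtain v where "Poly_Mapping.lookup f v \<noteq> 0"
    by (metis lookup_zero poly_mapping_eqI)
  then obtain g where "f = Poly_Mapping.single v 1 + g"
    by (rule split_off_variable)
  then have "k = Poly_Mapping.single v 1 + (m + g)"
    using mf(1) by (simp add: add.left_commute)
  then show ?thesis
    unfolding var_mult_def using linear_quotients_add_closed[OF U mf(2)] by blast
qed

lemma linear_quotients_var_mult_subset: "linear_quotients d U \<Longrightarrow> var_mult U \<subseteq> U"
  unfolding var_mult_def using linear_quotients_add_closed by (auto simp: add.commute)

text \<open>If \<open>m\<close> has the colon ideal \<open>(V)\<close>, then the monomials \<open>x\<^sub>v m\<close> with \<open>v \<notin> V\<close> are the new generators,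
  and the colon ideal of each of them is generated by \<open>V\<close> and the \<open>v\<close> already treated.\<close>

lemma linear_quotients_var_mult:
  assumes "linear_quotients d U"
  shows "linear_quotients (Suc d) (var_mult U)"
  using assms
proof induction
  case empty
  then show ?case
    by (simp add: var_mult_def linear_quotients.empty)
next
  case (add U m V)
  let ?R = "\<lambda>W. \<Union>v\<in>W. range ((+) (m + Poly_Mapping.single v 1))"
  have U_iff: "m + f \<in> U \<longleftrightarrow> f \<in> meets V" for f
    using add.hyps(3) by blast
  \<comment> \<open>These exponents have degree above \<open>d\<close>, where
    \<open>var_mult U\<close> and \<open>U\<close> agree.\<close>
  have mult_iff: "m + Poly_Mapping.single x 1 + f \<in> var_mult U \<longleftrightarrow> Poly_Mapping.single x 1 + f \<in> meets V" for x f
    using U_iff linear_quotients_var_mult_subset[OF add.hyps(1)]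
      linear_quotients_in_var_mult[OF add.hyps(1), of "m + Poly_Mapping.single x 1 + f"] add.hyps(2)
    by (auto simp: add.assoc)
  \<comment> \<open>\<open>W\<close> collects the variables outside \<open>V\<close> treated so far.
    For \<open>v\<close> in \<open>V\<close> the monomial \<open>x_v m\<close> already lies in
    \<open>var_mult U\<close>.\<close>
  have "linear_quotients (Suc d) (var_mult U \<union> ?R W)" if "finite W" "W \<inter> V = {}" for W
    using that
  proof (induction W rule: finite_induct)
    case empty
    then show ?case
      using add.IH by simp
  next
    case (insert x W)
    have "{f. m + Poly_Mapping.single x 1 + f \<in> var_mult U \<union> ?R W} = meets (V \<union> W)"
    proof (rule set_eqI)
      fix f
      have "Poly_Mapping.single x 1 + f \<in> meets V \<longleftrightarrow> f \<in> meets V"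
        using insert.prems by (auto simp: meets_def lookup_add lookup_single when_def) 
      moreover have "m + Poly_Mapping.single x 1 + f \<in> ?R W \<longleftrightarrow> f \<in> meets W"
      proof
        assume "m + Poly_Mapping.single x 1 + f \<in> ?R W"
        then obtain w g where w: "w \<in> W" "m + Poly_Mapping.single x 1 + f = m + Poly_Mapping.single w 1 + g"
          by blast
        then have "Poly_Mapping.lookup (Poly_Mapping.single x 1 + f) w = Poly_Mapping.lookup (Poly_Mapping.single w 1 + g) w"
          by (simp add: add.assoc)
        moreover have "x \<noteq> w"
          using w(1) insert.hyps(2) by blast
        ultimately show "f \<in> meets W"
          using w(1) by (auto simp: meets_def lookup_add lookup_single intro!: bexI[of _ w])
      next
        assume "f \<in> meets W"
        then obtain w g where "w \<in> W" "f = Poly_Mapping.single w 1 + g"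
          unfolding meets_iff_split by blast
        then have "m + Poly_Mapping.single x 1 + f = m + Poly_Mapping.single w 1 + (Poly_Mapping.single x 1 + g)"
          by (simp add: ac_simps)
        then show "m + Poly_Mapping.single x 1 + f \<in> ?R W"
          using \<open>w \<in> W\<close> by blast
      qed
      ultimately show "f \<in> {f. m + Poly_Mapping.single x 1 + f \<in> var_mult U \<union> ?R W} \<longleftrightarrow> f \<in> meets (V \<union> W)"
        using mult_iff by (auto simp: meets_def)
    qed
    moreover have "var_mult U \<union> ?R (insert x W) = (var_mult U \<union> ?R W) \<union> range ((+) (m + Poly_Mapping.single x 1))"
      by auto
    ultimately show ?case
      using insert add.hyps(2) linear_quotients.add[of "Suc d" "var_mult U \<union> ?R W" "m + Poly_Mapping.single x 1" "V \<union> W"]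
      by auto
  qed
  then have "linear_quotients (Suc d) (var_mult U \<union> ?R (- V))"
    by auto
  moreover have "var_mult (U \<union> range ((+) m)) = var_mult U \<union> ?R (- V)"
  proof
    show "var_mult (U \<union> range ((+) m)) \<subseteq> var_mult U \<union> ?R (- V)"
    proof
      fix k assume "k \<in> var_mult (U \<union> range ((+) m))"
      then obtain v g where vg: "k = Poly_Mapping.single v 1 + g" "g \<in> U \<or> (\<exists>f. g = m + f)"
        unfolding var_mult_def by blast
      show "k \<in> var_mult U \<union> ?R (- V)"
      proof (cases "g \<in> U")
        case True
        then show ?thesis
          unfolding var_mult_def using vg(1) by blast
      next
        case False
        then obtain f where "g = m + f"
          using vg(2) by blast
        then have 2: "k = m + Poly_Mapping.single v 1 + f"
          unfolding vg(1) by (simp add: ac_simps)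
        show ?thesis
        proof (cases "v \<in> V")
          case True
          then have "k \<in> var_mult U"
            unfolding 2 mult_iff by (auto simp: meets_def lookup_add intro!: bexI[of _ v])
          then show ?thesis by blast
        qed (use 2 in blast)
      qed
    qed
    have "m + Poly_Mapping.single v 1 + f \<in> var_mult (U \<union> range ((+) m))" for v f
    proof -
      have "m + Poly_Mapping.single v 1 + f = Poly_Mapping.single v 1 + (m + f)"
        by (simp add: ac_simps)
      then show ?thesis unfolding var_mult_def by blast
    qed
    then show "var_mult U \<union> ?R (- V) \<subseteq> var_mult (U \<union> range ((+) m))"
      unfolding var_mult_def by blast
  qed
  ultimately show ?case
    by simp
qed

lemma ideal_gen_degree_component:
  assumes "\<And>m f. m \<in> U \<Longrightarrow> m + f \<in> U"
  shows "ideal_gen {p \<in> mono_ideal U. homog p (int d)} =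
    (mono_ideal (upset {m \<in> U. mdeg m = d}) :: 'k::comm_ring_1 mpoly4 set)"
proof (rule ideal_gen_eq_mono_ideal)
  show "{p \<in> mono_ideal U. homog p (int d)} \<subseteq> (mono_ideal (upset {m \<in> U. mdeg m = d}) :: 'k mpoly4 set)"
    by (auto simp: mono_ideal_def homog_def intro!: upset_base)
  show "Poly_Mapping.single m 1 \<in> ideal_gen {p \<in> (mono_ideal U :: 'k mpoly4 set). homog p (int d)}"
    if "m \<in> {m \<in> U. mdeg m = d}" for m
    using that by (intro ideal_gen_base) (auto simp: single_in_mono_ideal homog_def)
qed

text \<open>From degree \<open>d\<close> on, passing to the next component is multiplication by the
  maximal ideal, which preserves linear quotients; below \<open>d\<close> the component is
  zero.\<close>

lemma linear_quotients_degree_component: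
  assumes U: "linear_quotients d U"
  shows "linear_quotients e (upset {m \<in> U. mdeg m = e})"
proof (cases "d \<le> e")
  case True
  then show ?thesis
  proof (induction e rule: dec_induct)
    case base
    have "upset {m \<in> U. mdeg m = d} = U"
      using linear_quotients_generated[OF U] linear_quotients_add_closed[OF U]
      unfolding upset_def by fastforce
    then show ?case
      using U by simp
  next
    case (step e)
    have "var_mult (upset {m \<in> U. mdeg m = e}) = upset {m \<in> U. mdeg m = Suc e}"
    proof
      show "var_mult (upset {m \<in> U. mdeg m = e}) \<subseteq> upset {m \<in> U. mdeg m = Suc e}"
      proof
        fix k assume "k \<in> var_mult (upset {m \<in> U. mdeg m = e})"
        then obtain v s f where "s \<in> U" "mdeg s = e" "k = (s + Poly_Mapping.single v 1) + f"
          unfolding var_mult_def upset_def by (auto simp: ac_simps)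
        moreover have "s + Poly_Mapping.single v 1 \<in> U"
          using linear_quotients_add_closed[OF U] \<open>s \<in> U\<close> by blast
        ultimately show "k \<in> upset {m \<in> U. mdeg m = Suc e}"
          unfolding \<open>k = _\<close> by (intro upset_add upset_base) simp
      qed
      show "upset {m \<in> U. mdeg m = Suc e} \<subseteq> var_mult (upset {m \<in> U. mdeg m = e})"
      proof
        fix k assume "k \<in> upset {m \<in> U. mdeg m = Suc e}"
        then obtain s f where s: "s \<in> U" "mdeg s = Suc e" "k = s + f"
          unfolding upset_def by blast
        then have "s \<in> var_mult U"
          using linear_quotients_in_var_mult[OF U] step by simp
        then obtain v s' where v: "s = Poly_Mapping.single v 1 + s'" "s' \<in> U"
          unfolding var_mult_def by blast
        then have "k = Poly_Mapping.single v 1 + (s' + f)"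
          using s by (simp add: ac_simps)
        moreover have "s' + f \<in> upset {m \<in> U. mdeg m = e}"
          using v s by (intro upset_add upset_base) simp
        ultimately show "k \<in> var_mult (upset {m \<in> U. mdeg m = e})"
          unfolding var_mult_def by blast
      qed
    qed
    then show ?case
      using linear_quotients_var_mult[OF step.IH] by simp
  qed
next
  case False
  then have "{m \<in> U. mdeg m = e} = {}"
    using linear_quotients_generated[OF U] by fastforce
  then have "upset {m \<in> U. mdeg m = e} = {}"
    unfolding upset_def by blast
  then show ?thesis
    by (simp add: linear_quotients.empty)
qed

lemma linear_quotients_linear_res:
  assumes "linear_quotients d U"
  shows "linear_res (mono_ideal U :: 'k::field mpoly4 set)" "comp_linear (mono_ideal U :: 'k::field mpoly4 set)"
proof -
  show "linear_res (mono_ideal U :: 'k::field mpoly4 set)"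
    using linear_quotients_resolved[OF assms] by (rule resolved_imp_linear_res)
  show "comp_linear (mono_ideal U :: 'k::field mpoly4 set)"
    unfolding comp_linear_def
  proof
    fix e
    have "ideal_gen {p \<in> mono_ideal U. homog p (int e)} =
        (mono_ideal (upset {m \<in> U. mdeg m = e}) :: 'k mpoly4 set)"
      using linear_quotients_add_closed[OF assms] by (rule ideal_gen_degree_component)
    then show "linear_res (ideal_gen {p \<in> (mono_ideal U :: 'k mpoly4 set). homog p (int e)})"
      using linear_quotients_resolved[OF linear_quotients_degree_component[OF assms]]
      by (metis resolved_imp_linear_res)
  qed
qed

text \<open>If \<open>m + f\<close> is a multiple of the earlier \<open>m'\<close>, then
  \<open>f\<close> must contain the variable \<open>v\<close> in which \<open>m'\<close> exceeds
  \<open>m\<close>. As \<open>m''\<close> divides \<open>x_v m\<close>, that \<open>v\<close>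
  already belongs to the colon ideal, which is thus generated by variables.\<close>

lemma linear_quotients_by_rank:
  fixes \<rho> :: "(var \<Rightarrow>\<^sub>0 nat) \<Rightarrow> nat"
  assumes deg: "\<And>m. m \<in> S \<Longrightarrow> mdeg m = d" and bound: "\<And>m. m \<in> S \<Longrightarrow> \<rho> m < n" and inj: "inj_on \<rho> S"
    and step: "\<And>m m'. m \<in> S \<Longrightarrow> m' \<in> S \<Longrightarrow> \<rho> m' < \<rho> m \<Longrightarrow>
      \<exists>v m''. Poly_Mapping.lookup m v < Poly_Mapping.lookup m' v \<and> m'' \<in> S \<and> \<rho> m'' < \<rho> m \<and>
        (\<forall>x. Poly_Mapping.lookup m'' x \<le> Poly_Mapping.lookup (m + Poly_Mapping.single v 1) x)"
  shows "linear_quotients d (upset S)"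
proof -
  have "linear_quotients d (upset {m \<in> S. \<rho> m < n})" for n
  proof (induction n)
    case 0
    then show ?case
      by (simp add: upset_def linear_quotients.empty)
  next
    case (Suc n)
    let ?S = "{m \<in> S. \<rho> m < n}"
    show ?case
    proof (cases "\<exists>m\<in>S. \<rho> m = n")
      case True
      then obtain m where m: "m \<in> S" "\<rho> m = n" by blast
      define V where "V = {v. m + Poly_Mapping.single v 1 \<in> upset ?S}"
      have "{f. m + f \<in> upset ?S} = meets V"
      proof
        show "{f. m + f \<in> upset ?S} \<subseteq> meets V"
        proof clarify
          fix f assume "m + f \<in> upset ?S"
          then obtain m' where m': "m' \<in> S" "\<rho> m' < n"
              "\<forall>v. Poly_Mapping.lookup m' v \<le> Poly_Mapping.lookup (m + f) v"
            unfolding upset_iff_le by blast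
          then obtain v m'' where v: "Poly_Mapping.lookup m v < Poly_Mapping.lookup m' v" "m'' \<in> S" "\<rho> m'' < n"
              "\<forall>x. Poly_Mapping.lookup m'' x \<le> Poly_Mapping.lookup (m + Poly_Mapping.single v 1) x"
            using step[OF m(1) m'(1)] m(2) by blast
          have "v \<in> V"
            unfolding V_def upset_iff_le using v by blast
          moreover have "Poly_Mapping.lookup f v \<noteq> 0"
            using v(1) m'(3) by (metis add.right_neutral lookup_add not_less)
          ultimately show "f \<in> meets V"
            unfolding meets_def by blast
        qed
        show "meets V \<subseteq> {f. m + f \<in> upset ?S}"
        proof clarify
          fix f assume "f \<in> meets V"
          then obtain v g where v: "v \<in> V" "f = Poly_Mapping.single v 1 + g"
            unfolding meets_iff_split by blast
          then have "m + Poly_Mapping.single v 1 + g \<in> upset ?S"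
            unfolding V_def using upset_add[of "m + Poly_Mapping.single v 1"] by blast
          then show "m + f \<in> upset ?S"
            by (simp add: v(2) add.assoc)
        qed
      qed
      moreover have "{m \<in> S. \<rho> m < Suc n} = insert m ?S"
        using m inj by (auto simp: less_Suc_eq inj_on_def)
      moreover have "upset (insert m ?S) = upset ?S \<union> range ((+) m)"
        by (auto simp: upset_def)
      ultimately show ?thesis
        using linear_quotients.add[OF Suc deg[OF m(1)]] by simp
    next
      case False
      then have "{m \<in> S. \<rho> m < Suc n} = ?S"
        by (auto simp: less_Suc_eq)
      then show ?thesis
        using Suc by simp
    qed
  qed
  moreover have "{m \<in> S. \<rho> m < n} = S"
    using bound by blast
  ultimately show ?thesis
    by metis
qed

section \<open>Curves without reductions\<close>

lemma lex_less:
  fixes N :: nat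
  assumes "x < N" "y < N"
  shows "i * N + x < j * N + y \<longleftrightarrow> i < j \<or> i = j \<and> x < y"
proof -
  have *: "i * N + x < j * N + y" if "i < j" "x < N" for i j x y
  proof -
    have "i * N + x < Suc i * N" using that by simp
    also have "\<dots> \<le> j * N" using that(1) by (intro mult_le_mono1) simp
    finally show ?thesis by simp
  qed
  show ?thesis
    using *[of i j x y] *[of j i y x] assms by (cases i j rule: linorder_cases) auto
qed

lemma mdeg_distinct:
  assumes "distinct [s, t, u, w]" "(UNIV :: var set) = {s, t, u, w}"
  shows "mdeg m = Poly_Mapping.lookup m s + Poly_Mapping.lookup m t + Poly_Mapping.lookup m u + Poly_Mapping.lookup m w"
  unfolding mdeg_UNIV assms(2) using assms(1) by simp

text \<open>Both halves move one unit at a time: dividing by a variable shows that the minimal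
  generators have degree \<open>p\<close> on \<open>st\<close> and \<open>q\<close> on
  \<open>uw\<close>, and steps to neighbouring lattice points give the linear quotients.\<close>

lemma linear_quotients_cut_rectangle_le:
  fixes s t u w :: var and p q \<alpha> \<beta> \<gamma> \<delta> :: nat
  assumes dist: "distinct [s, t, u, w]" and univ: "(UNIV :: var set) = {s, t, u, w}"
    and ineq: "p > \<alpha> + \<gamma>" "p > \<beta> + \<delta>" "q > \<alpha> + \<beta>" "q > \<gamma> + \<delta>" and "\<gamma> \<le> \<alpha>"
  defines "l \<equiv> Poly_Mapping.lookup"
  defines "U \<equiv> {m. p \<le> l m s + l m t \<and> q \<le> l m u + l m w \<and> \<alpha> \<le> l m s + l m u \<and> \<beta> \<le> l m s + l m w \<and>
    \<gamma> \<le> l m t + l m u \<and> \<delta> \<le> l m t + l m w}"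
  shows "linear_quotients (p + q) U"
proof -
  let ?e = "\<lambda>v. Poly_Mapping.single v (1::nat)"
  have neq: "s \<noteq> t" "s \<noteq> u" "s \<noteq> w" "t \<noteq> u" "t \<noteq> w" "u \<noteq> w"
    "t \<noteq> s" "u \<noteq> s" "w \<noteq> s" "u \<noteq> t" "w \<noteq> t" "w \<noteq> u"
    using dist by auto
  have all: "(\<forall>v. P v) \<longleftrightarrow> P s \<and> P t \<and> P u \<and> P w" for P
    using univ by (metis UNIV_I empty_iff insert_iff)
  have look: "l (m + ?e v) x = l m x + (if x = v then 1 else 0)"
      "l (m - ?e v) x = l m x - (if x = v then 1 else 0)"
      "l (m + ?e v - ?e v') x = l m x + (if x = v then 1 else 0) - (if x = v' then 1 else 0)" for m v v' x
    unfolding l_def by (auto simp: lookup_add lookup_minus lookup_single when_def)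
  define S where "S = {m \<in> U. l m s + l m t = p \<and> l m u + l m w = q}"
  have "U = upset S"
  proof
    show "upset S \<subseteq> U"
      unfolding upset_def S_def U_def l_def by (auto simp: lookup_add)
    have "m \<in> upset S" if "m \<in> U" for m
      using that
    proof (induction "mdeg m" arbitrary: m rule: less_induct)
      case less
      have mU: "p \<le> l m s + l m t" "q \<le> l m u + l m w" "\<alpha> \<le> l m s + l m u" "\<beta> \<le> l m s + l m w"
          "\<gamma> \<le> l m t + l m u" "\<delta> \<le> l m t + l m w"
        using less.prems by (auto simp: U_def)
      have descend: "m \<in> upset S" if nz: "l m v \<noteq> 0" and U: "m - ?e v \<in> U" for v
      proof -
        obtain f where f: "m = ?e v + f"
          using nz unfolding l_def by (rule split_off_variable)
        then have "f = m - ?e v" by simp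
        then have "f \<in> upset S"
          using less.hyps[of f] U f by simp
        then show ?thesis
          unfolding f by (metis add.commute upset_add)
      qed
      show ?case
      proof (cases "m \<in> S")
        case True
        then show ?thesis by (rule upset_base)
      next
        case False
        then have "l m s + l m t > p \<or> l m u + l m w > q"
          using less.prems unfolding S_def U_def by auto
        then show ?thesis
        proof
          assume gt: "l m s + l m t > p"
          \<comment> \<open>If both \<open>s\<close> and \<open>t\<close> were blocked by tight
            edges, adding one tight condition for each would bound either
            \<open>l m s + l m t\<close> by less than \<open>p\<close> or the total degree by less
            than \<open>p + q\<close>. A zero exponent at one of them leaves the other too large to
            be blocked.\<close>
          have "(0 < l m s \<and> \<alpha> < l m s + l m u \<and> \<beta> < l m s + l m w) \<or>
              (0 < l m t \<and> \<gamma> < l m t + l m u \<and> \<delta> < l m t + l m w)"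
            using gt mU(2) ineq by linarith
          then have "(l m s \<noteq> 0 \<and> m - ?e s \<in> U) \<or> (l m t \<noteq> 0 \<and> m - ?e t \<in> U)"
            unfolding U_def mem_Collect_eq look using mU gt by (auto simp: neq)
          then show ?thesis
            using descend by blast
        next
          assume gt: "l m u + l m w > q"
          have "(0 < l m u \<and> \<alpha> < l m s + l m u \<and> \<gamma> < l m t + l m u) \<or>
              (0 < l m w \<and> \<beta> < l m s + l m w \<and> \<delta> < l m t + l m w)"
            using gt mU(1) ineq by linarith
          then have "(l m u \<noteq> 0 \<and> m - ?e u \<in> U) \<or> (l m w \<noteq> 0 \<and> m - ?e w \<in> U)"
            unfolding U_def mem_Collect_eq look using mU gt by (auto simp: neq)
          then show ?thesis
            using descend by blast
        qed
      qed
    qed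
    then show "U \<subseteq> upset S" by blast
  qed
  moreover have "linear_quotients (p + q) (upset S)"
  proof -
    \<comment> \<open>The generators are lattice points \<open>(l m s, l m u)\<close> of a rectangle with its corners cut off
      diagonally.  The rows \<open>\<alpha>, \<alpha> + 1, \<dots>, q\<close> come first, then \<open>\<alpha> - 1, \<dots>, 0\<close>, each from left to
      right.\<close>
    define row where "row = (\<lambda>m. if \<alpha> \<le> l m u then l m u else q + 1 + (\<alpha> - l m u))"
    define \<rho> where "\<rho> = (\<lambda>m. row m * (p + 1) + l m s)"
    have le_p: "l m s < p + 1" if "m \<in> S" for m
      using that by (auto simp: S_def)
    have \<rho>_less: "\<rho> m' < \<rho> m \<longleftrightarrow> row m' < row m \<or> row m' = row m \<and> l m' s < l m s"
      if "m \<in> S" "m' \<in> S" for m m'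
      unfolding \<rho>_def using that le_p by (intro lex_less) auto
    show ?thesis
    proof (rule linear_quotients_by_rank)
      show "mdeg m = p + q" if "m \<in> S" for m
        using that mdeg_distinct[OF dist univ, of m] by (simp add: S_def l_def)
      show "\<rho> m < (2 * q + 2) * (p + 1)" if "m \<in> S" for m
      proof -
        have "row m < 2 * q + 2"
          \<comment> \<open>The last row has number at most \<open>q + 1 + \<alpha>\<close>, and
            \<open>\<alpha> < q\<close>.\<close>
          using that ineq by (auto simp: row_def S_def)
        then have "\<rho> m < (2 * q + 2) * (p + 1) + 0"
          unfolding \<rho>_def using le_p[OF that] by (subst lex_less) auto
        then show ?thesis by simp
      qed
      show "inj_on \<rho> S"
      proof (rule inj_onI)
        fix m m' assume m: "m \<in> S" "m' \<in> S" "\<rho> m = \<rho> m'"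
        then have "row m = row m'" "l m s = l m' s"
          using \<rho>_less[of m m'] \<rho>_less[of m' m] by auto
        moreover from this(1) have "l m u = l m' u"
          using m(1,2) unfolding row_def S_def by (auto split: if_splits)
        ultimately have "\<forall>v. l m v = l m' v"
          unfolding all using m(1,2) by (auto simp: S_def)
        then show "m = m'"
          unfolding l_def by (auto intro: poly_mapping_eqI)
      qed
      fix m m' assume m: "m \<in> S" "m' \<in> S" and less: "\<rho> m' < \<rho> m"
      have lt: "row m' < row m \<or> row m' = row m \<and> l m' s < l m s"
        using less \<rho>_less m by blast
      show "\<exists>v m''. Poly_Mapping.lookup m v < Poly_Mapping.lookup m' v \<and> m'' \<in> S \<and> \<rho> m'' < \<rho> m \<and>
        (\<forall>x. Poly_Mapping.lookup m'' x \<le> Poly_Mapping.lookup (m + ?e v) x)" (is ?G)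
      proof -
        have neighbour: ?G if "l m v < l m' v" "m + ?e v - ?e v' \<in> S" "\<rho> (m + ?e v - ?e v') < \<rho> m" for v v'
        proof -
          have "\<forall>x. l (m + ?e v - ?e v') x \<le> l (m + ?e v) x"
            unfolding look by simp
          then show ?thesis
            using that unfolding l_def by blast
        qed
        have left: ?G if "l m t < l m' t" "m + ?e t - ?e s \<in> S" "l m s \<noteq> 0"
        proof -
          have "row (m + ?e t - ?e s) = row m"
            unfolding row_def look by (simp add: neq)
          then have "\<rho> (m + ?e t - ?e s) < \<rho> m"
            using that(3) unfolding \<rho>_less[OF m(1) that(2)] look by (simp add: neq)
          then show ?thesis
            using that(1,2) neighbour by blast
        qed
        have mS: "l m s + l m t = p" "l m u + l m w = q" "\<alpha> \<le> l m s + l m u" "\<beta> \<le> l m s + l m w"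
            "\<gamma> \<le> l m t + l m u" "\<delta> \<le> l m t + l m w"
          and mS': "l m' s + l m' t = p" "l m' u + l m' w = q" "\<alpha> \<le> l m' s + l m' u" "\<beta> \<le> l m' s + l m' w"
            "\<gamma> \<le> l m' t + l m' u" "\<delta> \<le> l m' t + l m' w"
          using m unfolding S_def U_def by auto
        \<comment> \<open>Each earlier generator prescribes a move: left within the row, or one row
          towards row \<open>\<alpha>\<close>. The latter can fail only at the cut of
          \<open>\<delta>\<close>, and there a move to the left succeeds.\<close>
        consider (same) "l m' u = l m u" "l m' s < l m s"
          | (down) "l m u > \<alpha>" "l m' u < l m u"
          | (up) "l m u < \<alpha>" "l m' u > l m u" "l m t + l m w > \<delta>"
          | (corner) "l m u < \<alpha>" "l m' u > l m u" "l m t + l m w = \<delta>"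
          using lt mS(2,6) mS'(2) unfolding row_def by (fastforce split: if_splits)
        then show ?G
        proof cases
          case same
          have "m + ?e t - ?e s \<in> S"
            unfolding S_def U_def mem_Collect_eq look using same mS mS' by (auto simp: neq)
          then show ?thesis
            using left same mS(1) mS'(1) by simp
        next
          case down
          \<comment> \<open>From \<open>\<gamma> \<le> \<alpha> < l m u\<close>, lowering the
            exponent of \<open>u\<close> by one respects both edges through
            \<open>u\<close>.\<close>
          have *: "m + ?e w - ?e u \<in> S"
            unfolding S_def U_def mem_Collect_eq look using down mS ineq \<open>\<gamma> \<le> \<alpha>\<close> by (auto simp: neq)
          moreover have "row (m + ?e w - ?e u) < row m"
            unfolding row_def look using down by (auto simp: neq)
          ultimately show ?thesis
            using neighbour[of w u] down mS(2) mS'(2) \<rho>_less[OF m(1) *] by simp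
        next
          case up
          have *: "m + ?e u - ?e w \<in> S"
            unfolding S_def U_def mem_Collect_eq look using up mS ineq by (auto simp: neq)
          moreover have "row (m + ?e u - ?e w) < row m"
            unfolding row_def look using up mS(2) ineq by (auto simp: neq)
          ultimately show ?thesis
            using neighbour[of u w] up \<rho>_less[OF m(1) *] by simp
        next
          case corner
          \<comment> \<open>On the cut of \<open>\<delta>\<close> the strict inequalities leave
            slack on both edges through \<open>s\<close>. The point \<open>m'\<close> has a smaller
            exponent at \<open>w\<close>, hence a larger one at \<open>t\<close>.\<close>
          have "m + ?e t - ?e s \<in> S"
            unfolding S_def U_def mem_Collect_eq look using corner mS ineq by (auto simp: neq)
          then show ?thesis
            using left corner mS mS' ineq by simp
        qed
      qed
    qed
  qed
  ultimately show ?thesis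
    by simp
qed

section \<open>Exponents of tetrahedral ideals\<close>

lemma X_power: "X v ^ n = (Poly_Mapping.single (Poly_Mapping.single v n) 1 :: 'k::comm_ring_1 mpoly4)"
  by (induction n) (simp_all add: X_def mult_single flip: single_add)

lemma pow_ideal_eq:
  assumes "u \<noteq> v"
  shows "pow_ideal u v n = (mono_ideal {m. n \<le> Poly_Mapping.lookup m u + Poly_Mapping.lookup m v} :: 'k::comm_ring_1 mpoly4 set)"
proof -
  let ?S = "{Poly_Mapping.single u i + Poly_Mapping.single v (n - i) | i. i \<le> n}"
  have "{X u ^ i * X v ^ (n - i) | i. i \<le> n} = (\<lambda>m. Poly_Mapping.single m (1::'k)) ` ?S"
    by (auto simp: X_power mult_single)
  moreover have "upset ?S = {m. n \<le> Poly_Mapping.lookup m u + Poly_Mapping.lookup m v}"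
  proof
    show "upset ?S \<subseteq> {m. n \<le> Poly_Mapping.lookup m u + Poly_Mapping.lookup m v}"
      using assms by (auto simp: upset_def lookup_add lookup_single when_def)
    show "{m. n \<le> Poly_Mapping.lookup m u + Poly_Mapping.lookup m v} \<subseteq> upset ?S"
    proof clarify
      fix m assume m: "n \<le> Poly_Mapping.lookup m u + Poly_Mapping.lookup m v"
      define i where "i = min n (Poly_Mapping.lookup m u)"
      have "\<forall>x. Poly_Mapping.lookup (Poly_Mapping.single u i + Poly_Mapping.single v (n - i)) x \<le> Poly_Mapping.lookup m x"
        using assms m by (auto simp: lookup_add lookup_single when_def i_def)
      moreover have "Poly_Mapping.single u i + Poly_Mapping.single v (n - i) \<in> ?S"
        unfolding i_def by (intro CollectI exI[of _ "min n (Poly_Mapping.lookup m u)"]) simp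
      ultimately show "m \<in> upset ?S"
        unfolding upset_iff_le by blast
    qed
  qed
  ultimately show ?thesis
    unfolding pow_ideal_def by (simp add: ideal_gen_monomials)
qed

definition tet_exps :: "(nat \<Rightarrow> nat) \<Rightarrow> (var \<Rightarrow>\<^sub>0 nat) set" where
  "tet_exps a = {m. a 1 \<le> Poly_Mapping.lookup m A + Poly_Mapping.lookup m B \<and>
    a 2 \<le> Poly_Mapping.lookup m A + Poly_Mapping.lookup m C \<and>
    a 3 \<le> Poly_Mapping.lookup m A + Poly_Mapping.lookup m D \<and>
    a 4 \<le> Poly_Mapping.lookup m B + Poly_Mapping.lookup m C \<and>
    a 5 \<le> Poly_Mapping.lookup m B + Poly_Mapping.lookup m D \<and>
    a 6 \<le> Poly_Mapping.lookup m C + Poly_Mapping.lookup m D}"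

lemma atLeastAtMost_1_6: "{1..6::nat} = {1, 2, 3, 4, 5, 6}"
  by auto

lemma tet_ideal_eq: "tet_ideal a = (mono_ideal (tet_exps a) :: 'k::comm_ring_1 mpoly4 set)"
  unfolding tet_ideal_def atLeastAtMost_1_6
  by (auto simp: pair_def pow_ideal_eq mono_ideal_def tet_exps_def)

text \<open>Interchanging \<open>s\<close> and \<open>t\<close> swaps \<open>\<alpha>\<close> with
  \<open>\<gamma>\<close> and \<open>\<beta>\<close> with \<open>\<delta>\<close> and preserves the
  inequalities, so \<open>\<gamma> \<le> \<alpha>\<close> may be assumed.\<close>

lemma linear_quotients_cut_rectangle:
  fixes s t u w :: var and p q \<alpha> \<beta> \<gamma> \<delta> :: nat
  assumes dist: "distinct [s, t, u, w]" and univ: "(UNIV :: var set) = {s, t, u, w}"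
    and ineq: "p > \<alpha> + \<gamma>" "p > \<beta> + \<delta>" "q > \<alpha> + \<beta>" "q > \<gamma> + \<delta>"
  defines "l \<equiv> Poly_Mapping.lookup"
  defines "U \<equiv> {m. p \<le> l m s + l m t \<and> q \<le> l m u + l m w \<and> \<alpha> \<le> l m s + l m u \<and> \<beta> \<le> l m s + l m w \<and>
    \<gamma> \<le> l m t + l m u \<and> \<delta> \<le> l m t + l m w}"
  shows "linear_quotients (p + q) U"
proof (cases "\<gamma> \<le> \<alpha>")
  case True
  then show ?thesis
    unfolding U_def l_def using linear_quotients_cut_rectangle_le[OF dist univ ineq] by blast
next
  case False
  have "U = {m. p \<le> l m t + l m s \<and> q \<le> l m u + l m w \<and> \<gamma> \<le> l m t + l m u \<and> \<delta> \<le> l m t + l m w \<and>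
      \<alpha> \<le> l m s + l m u \<and> \<beta> \<le> l m s + l m w}"
    unfolding U_def by (auto simp: add.commute)
  then show ?thesis
    unfolding l_def
    using linear_quotients_cut_rectangle_le[of t s u w \<gamma> \<alpha> p \<delta> \<beta> q] False dist univ ineq
    by (simp add: insert_commute add.commute eq_commute[of t s])
qed

text \<open>View \<open>a\<close> as a weighting of the edges of the tetrahedron on the four variables.  A failing reduction at a
  vertex means that some edge outweighs the sum of the two edges joining it to that vertex; applied to
  the ends of a heaviest edge this singles out a pair of opposite edges.\<close>

lemma not_reducible_cases:
  assumes "\<not> (\<exists>v. red_cond v a)"
  shows "(a 6 > a 2 + a 3 \<and> a 6 > a 4 + a 5 \<and> a 1 > a 2 + a 4 \<and> a 1 > a 3 + a 5) \<or>
    (a 5 > a 1 + a 3 \<and> a 5 > a 4 + a 6 \<and> a 2 > a 1 + a 4 \<and> a 2 > a 3 + a 6) \<or>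
    (a 4 > a 1 + a 2 \<and> a 4 > a 5 + a 6 \<and> a 3 > a 1 + a 5 \<and> a 3 > a 2 + a 6)"
proof -
  have "a 4 > a 1 + a 2 \<or> a 5 > a 1 + a 3 \<or> a 6 > a 2 + a 3"
    "a 2 > a 1 + a 4 \<or> a 3 > a 1 + a 5 \<or> a 6 > a 4 + a 5"
    "a 1 > a 2 + a 4 \<or> a 3 > a 2 + a 6 \<or> a 5 > a 4 + a 6"
    "a 1 > a 3 + a 5 \<or> a 2 > a 3 + a 6 \<or> a 4 > a 5 + a 6"
    using assms[unfolded not_ex, THEN spec, of A] assms[unfolded not_ex, THEN spec, of B]
      assms[unfolded not_ex, THEN spec, of C] assms[unfolded not_ex, THEN spec, of D]
    by (auto simp: red_cond_def not_le)
  then show ?thesis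
    by (elim disjE) linarith+
qed

text \<open>The alternatives correspond to the three pairs of opposite edges; in each, the heavy
  pair is taken as \<open>st\<close>, \<open>uw\<close>, and the generating degree is the sum of its
  two entries.\<close>

lemma not_reducible_linear_quotients:
  assumes "\<not> (\<exists>v. red_cond v a)"
  shows "\<exists>d. linear_quotients d (tet_exps a)"
  using not_reducible_cases[OF assms]
proof (elim disjE)
  assume *: "a 6 > a 2 + a 3 \<and> a 6 > a 4 + a 5 \<and> a 1 > a 2 + a 4 \<and> a 1 > a 3 + a 5"
  have "tet_exps a = {m. a 1 \<le> Poly_Mapping.lookup m A + Poly_Mapping.lookup m B \<and>
    a 6 \<le> Poly_Mapping.lookup m C + Poly_Mapping.lookup m D \<and>
    a 2 \<le> Poly_Mapping.lookup m A + Poly_Mapping.lookup m C \<and>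
    a 3 \<le> Poly_Mapping.lookup m A + Poly_Mapping.lookup m D \<and>
    a 4 \<le> Poly_Mapping.lookup m B + Poly_Mapping.lookup m C \<and>
    a 5 \<le> Poly_Mapping.lookup m B + Poly_Mapping.lookup m D}"
    unfolding tet_exps_def by auto
  then show ?thesis
    using linear_quotients_cut_rectangle[of A B C D "a 2" "a 4" "a 1" "a 3" "a 5" "a 6"] *
    by (auto simp: UNIV_var)
next
  assume *: "a 5 > a 1 + a 3 \<and> a 5 > a 4 + a 6 \<and> a 2 > a 1 + a 4 \<and> a 2 > a 3 + a 6"
  have "tet_exps a = {m. a 2 \<le> Poly_Mapping.lookup m A + Poly_Mapping.lookup m C \<and>
    a 5 \<le> Poly_Mapping.lookup m B + Poly_Mapping.lookup m D \<and>
    a 1 \<le> Poly_Mapping.lookup m A + Poly_Mapping.lookup m B \<and>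
    a 3 \<le> Poly_Mapping.lookup m A + Poly_Mapping.lookup m D \<and>
    a 4 \<le> Poly_Mapping.lookup m C + Poly_Mapping.lookup m B \<and>
    a 6 \<le> Poly_Mapping.lookup m C + Poly_Mapping.lookup m D}"
    unfolding tet_exps_def by (auto simp: add.commute)
  then show ?thesis
    using linear_quotients_cut_rectangle[of A C B D "a 1" "a 4" "a 2" "a 3" "a 6" "a 5"] *
    by (auto simp: UNIV_var insert_commute)
next
  assume *: "a 4 > a 1 + a 2 \<and> a 4 > a 5 + a 6 \<and> a 3 > a 1 + a 5 \<and> a 3 > a 2 + a 6"
  have "tet_exps a = {m. a 3 \<le> Poly_Mapping.lookup m A + Poly_Mapping.lookup m D \<and>
    a 4 \<le> Poly_Mapping.lookup m B + Poly_Mapping.lookup m C \<and>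
    a 1 \<le> Poly_Mapping.lookup m A + Poly_Mapping.lookup m B \<and>
    a 2 \<le> Poly_Mapping.lookup m A + Poly_Mapping.lookup m C \<and>
    a 5 \<le> Poly_Mapping.lookup m D + Poly_Mapping.lookup m B \<and>
    a 6 \<le> Poly_Mapping.lookup m D + Poly_Mapping.lookup m C}"
    unfolding tet_exps_def by (auto simp: add.commute)
  then show ?thesis
    using linear_quotients_cut_rectangle[of A D B C "a 1" "a 5" "a 3" "a 2" "a 6" "a 4"] *
    by (auto simp: UNIV_var insert_commute)
qed

section \<open>Powers of a complete intersection of two quadrics\<close>

text \<open>\<open>exps\<close> is the set of exponents of the ideal \<open>(x\<^sub>s x\<^sub>t, x\<^sub>u x\<^sub>w)\<^sup>r\<close>.\<close>

locale opposite_edges =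
  fixes s t u w :: var and r :: nat
  assumes dist: "distinct [s, t, u, w]" and univ: "(UNIV :: var set) = {s, t, u, w}"
begin

definition exps :: "(var \<Rightarrow>\<^sub>0 nat) set" where
  "exps = {m. r \<le> Poly_Mapping.lookup m s + Poly_Mapping.lookup m u \<and>
    r \<le> Poly_Mapping.lookup m s + Poly_Mapping.lookup m w \<and>
    r \<le> Poly_Mapping.lookup m t + Poly_Mapping.lookup m u \<and>
    r \<le> Poly_Mapping.lookup m t + Poly_Mapping.lookup m w}"

definition gen :: "nat \<Rightarrow> var \<Rightarrow>\<^sub>0 nat" where
  "gen i = Poly_Mapping.single s i + Poly_Mapping.single t i +
    Poly_Mapping.single u (r - i) + Poly_Mapping.single w (r - i)"

lemma neq: "s \<noteq> t" "s \<noteq> u" "s \<noteq> w" "t \<noteq> u" "t \<noteq> w" "u \<noteq> w"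
  "t \<noteq> s" "u \<noteq> s" "w \<noteq> s" "u \<noteq> t" "w \<noteq> t" "w \<noteq> u"
  using dist by auto

lemma all_iff: "(\<forall>v. P v) \<longleftrightarrow> P s \<and> P t \<and> P u \<and> P w"
  using univ by (metis UNIV_I empty_iff insert_iff)

lemma eq_iff: "m = n \<longleftrightarrow> (Poly_Mapping.lookup m s = Poly_Mapping.lookup n s \<and>
    Poly_Mapping.lookup m t = Poly_Mapping.lookup n t \<and>
    Poly_Mapping.lookup m u = Poly_Mapping.lookup n u \<and>
    Poly_Mapping.lookup m w = Poly_Mapping.lookup n w)" for m n :: "var \<Rightarrow>\<^sub>0 nat"
  unfolding poly_mapping_eq_iff fun_eq_iff all_iff ..

lemma lookup_gen:
  "Poly_Mapping.lookup (gen i) s = i" "Poly_Mapping.lookup (gen i) t = i"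
  "Poly_Mapping.lookup (gen i) u = r - i" "Poly_Mapping.lookup (gen i) w = r - i"
  by (auto simp: gen_def lookup_add lookup_single when_def neq)

lemma mdeg_gen: "i \<le> r \<Longrightarrow> mdeg (gen i) = 2 * r"
  by (simp add: mdeg_distinct[OF dist univ] lookup_gen)

lemma exps_eq_upset: "exps = upset (gen ` {..<Suc r})"
proof (rule set_eqI)
  fix m :: "var \<Rightarrow>\<^sub>0 nat"
  let ?l = "Poly_Mapping.lookup m"
  have "m \<in> exps \<longleftrightarrow> (\<exists>i<Suc r. i \<le> ?l s \<and> i \<le> ?l t \<and> r - i \<le> ?l u \<and> r - i \<le> ?l w)"
  proof
    assume "m \<in> exps"
    then show "\<exists>i<Suc r. i \<le> ?l s \<and> i \<le> ?l t \<and> r - i \<le> ?l u \<and> r - i \<le> ?l w"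
      \<comment> \<open>The largest power of \<open>x_s x_t\<close> not above \<open>r\<close> that
        divides the monomial.\<close>
      by (intro exI[of _ "min r (min (?l s) (?l t))"]) (auto simp: exps_def min_def)
  qed (auto simp: exps_def)
  then show "m \<in> exps \<longleftrightarrow> m \<in> upset (gen ` {..<Suc r})"
    unfolding upset_iff_le all_iff by (auto simp: lookup_gen)
qed

lemma exps_add: "m \<in> exps \<Longrightarrow> m + f \<in> exps"
  by (auto simp: exps_def lookup_add)

text \<open>Generators are added by increasing power of \<open>x_s x_t\<close>. The predecessor of a
  new one divides its multiple by \<open>x_u x_w\<close>, and each earlier one requires this factor,
  so the colon ideal is principal of degree 2 and the resolution stops there.\<close>

lemma resolved_exps:
  "resolved [2 * r, 2] 1 (vec1 ` (mono_ideal exps :: 'k::comm_ring_1 mpoly4 set))"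
proof -
  have zero: "resolved es 1 (vec1 ` (mono_ideal {} :: 'k mpoly4 set))" for es
    by (simp add: mono_ideal_empty vec1_0 resolved_zero)
  have Q: "resolved [2] 1 (vec1 ` (mono_ideal (range ((+) (Poly_Mapping.single u 1 + Poly_Mapping.single w 1))) :: 'k mpoly4 set))"
    using resolved_add_monomial[of 2 "[]" "{}" "Poly_Mapping.single u 1 + Poly_Mapping.single w 1"]
      zero[of "[2]"] zero[of "[]"] by (simp del: resolved.simps)
  have "resolved [2 * r, 2] 1 (vec1 ` (mono_ideal (upset (gen ` {..<n})) :: 'k mpoly4 set))" if "n \<le> Suc r" for n
    using that
  proof (induction n)
    case 0
    have "upset {} = {}"
      by (simp add: upset_def)
    then show ?case
      using zero[of "[2 * r, 2]"] by (simp del: resolved.simps)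
  next
    case (Suc n)
    have colon: "resolved [2] 1 (vec1 ` (mono_ideal {f. gen n + f \<in> upset (gen ` {..<n})} :: 'k mpoly4 set))"
    proof (cases n)
      case 0
      then show ?thesis
        using zero[of "[2]"] by (simp add: upset_def del: resolved.simps)
    next
      case (Suc n')
      have "gen n + f \<in> upset (gen ` {..<n}) \<longleftrightarrow> f \<in> range ((+) (Poly_Mapping.single u 1 + Poly_Mapping.single w 1))" for f
      proof
        assume "gen n + f \<in> upset (gen ` {..<n})"
        then obtain i where i: "i < n" "r - i \<le> r - n + Poly_Mapping.lookup f u" "r - i \<le> r - n + Poly_Mapping.lookup f w"
          unfolding upset_iff_le all_iff by (auto simp: lookup_gen lookup_add)
        then have "Poly_Mapping.lookup f u \<ge> 1" "Poly_Mapping.lookup f w \<ge> 1"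
          using Suc.prems by auto
        then have "f = Poly_Mapping.single u 1 + Poly_Mapping.single w 1 + (f - (Poly_Mapping.single u 1 + Poly_Mapping.single w 1))"
          unfolding eq_iff by (auto simp: lookup_add lookup_minus lookup_single when_def neq)
        then show "f \<in> range ((+) (Poly_Mapping.single u 1 + Poly_Mapping.single w 1))"
          by (rule range_eqI)
      next
        assume "f \<in> range ((+) (Poly_Mapping.single u 1 + Poly_Mapping.single w 1))"
        then have "\<forall>v. Poly_Mapping.lookup (gen n') v \<le> Poly_Mapping.lookup (gen n + f) v"
          unfolding all_iff by (auto simp: lookup_gen lookup_add lookup_single when_def neq Suc)
        then show "gen n + f \<in> upset (gen ` {..<n})"
          unfolding upset_iff_le using Suc by blast
      qed
      then show ?thesis
        using Q by simp
    qed
    have "upset (gen ` {..<Suc n}) = upset (gen ` {..<n}) \<union> range ((+) (gen n))"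
      by (auto simp: upset_def lessThan_Suc)
    then show ?case
      using resolved_add_monomial[OF Suc.IH _ colon] Suc.prems by (simp add: mdeg_gen del: resolved.simps)
  qed
  then show ?thesis
    unfolding exps_eq_upset by blast
qed

lemma pure_res_exps: "pure_res (mono_ideal exps :: 'k::field mpoly4 set)"
proof -
  obtain b g M where "min_graded_res (mono_ideal exps :: 'k mpoly4 set) b (\<lambda>i j. int (2 * r) + int (sum_list (take i [2]))) g M"
    using resolved_imp_min_graded_res[OF resolved_exps, where 'k = 'k] by auto
  then show ?thesis
    unfolding pure_res_def by blast
qed

text \<open>Let \<open>\<gamma> k\<close> be the coefficient of \<open>(x\<^sub>s x\<^sub>t)\<^sup>r\<close> in the generator \<open>g k\<close>.  The functional
  \<open>v \<mapsto> \<Sum>k. \<gamma> k * v k\<close> kills all linear syzygies, because a single variable cannot move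
  \<open>(x\<^sub>s x\<^sub>t)\<^sup>r\<close> to a multiple of another monomial generator.  It does not kill the syzygy that
  comes from \<open>x\<^sub>u x\<^sub>w \<cdot> (x\<^sub>s x\<^sub>t)\<^sup>r = x\<^sub>s x\<^sub>t \<cdot> (x\<^sub>s x\<^sub>t)\<^sup>r\<^sup>-\<^sup>1 x\<^sub>u x\<^sub>w\<close>.\<close>

lemma not_linear_res_exps:
  assumes r: "r \<ge> 1"
  shows "\<not> linear_res (mono_ideal exps :: 'k::field mpoly4 set)"
proof
  let ?J = "mono_ideal exps :: 'k mpoly4 set"
  let ?l = "Poly_Mapping.lookup :: 'k mpoly4 \<Rightarrow> _"
  assume "linear_res ?J"
  then obtain b dg g M d where res: "min_graded_res ?J b dg g M" and dg: "\<And>i j. j < b i \<Longrightarrow> dg i j = d + int i"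
    unfolding linear_res_def by blast
  have gen_J: "?J = ideal_gen {g j | j. j < b 0}"
    using res unfolding min_graded_res_def by blast
  have hom_g: "homog (g j) d" if "j < b 0" for j
    using res dg[of j 0] that unfolding min_graded_res_def by auto
  have hom_M: "homog (M 1 k j) 1" if "k < b 0" "j < b 1" for k j
  proof -
    have "\<forall>i\<ge>1. \<forall>k<b (i - 1). \<forall>j<b i. homog (M i k j) (dg i j - dg (i - 1) k)"
      using res unfolding min_graded_res_def by blast
    from this[rule_format, of 1 k j] show ?thesis
      using dg[of k 0] dg[of j 1] that by simp
  qed
  have exact: "(\<Sum>k<b 0. v k * g k) = 0 \<longleftrightarrow> (\<exists>w. \<forall>k<b 0. v k = (\<Sum>j<b 1. M 1 k j * w j))" for v
    using res unfolding min_graded_res_def by blast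
  have g_exps: "Poly_Mapping.keys (g k) \<subseteq> exps" if "k < b 0" for k
    using that ideal_gen_base[of "g k" "{g j | j. j < b 0}"] gen_J by (auto simp: mono_ideal_def)
  have gen_in: "gen i \<in> exps" if "i \<le> r" for i
    using that by (auto simp: exps_def lookup_gen)
  have "Poly_Mapping.single (gen i) 1 \<in> ideal_gen {g j | j. j < b 0}" if "i \<le> r" for i
  proof -
    have "Poly_Mapping.single (gen i) 1 \<in> ?J"
      using gen_in[OF that] by (simp add: single_in_mono_ideal)
    then show ?thesis
      unfolding gen_J .
  qed
  then have comb: "\<exists>c. Poly_Mapping.single (gen i) 1 = (\<Sum>k<b 0. c k * g k)" if "i \<le> r" for i
    using that unfolding ideal_gen_indexed by blast
  obtain c where c: "Poly_Mapping.single (gen r) 1 = (\<Sum>k<b 0. c k * g k)"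
    using comb by blast
  obtain c' where c': "Poly_Mapping.single (gen (r - 1)) 1 = (\<Sum>k<b 0. c' k * g k)"
    using comb[of "r - 1"] by auto
  \<comment> \<open>The divisor \<open>y\<close> contains neither \<open>u\<close> nor
    \<open>w\<close>, so membership in \<open>exps\<close> forces the exponents of \<open>s\<close>
    and \<open>t\<close> up to \<open>r\<close>.\<close>
  have only: "y = gen r" "x = 0" if "x + y = gen r" "y \<in> exps" for x y
  proof -
    have eqs: "Poly_Mapping.lookup x v + Poly_Mapping.lookup y v = Poly_Mapping.lookup (gen r) v" for v
      using that(1) by (metis lookup_add)
    show "y = gen r"
      using eqs[of s] eqs[of t] eqs[of u] eqs[of w] that(2) unfolding eq_iff by (auto simp: lookup_gen exps_def)
    then show "x = 0"
      using that(1) by simp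
  qed
  define \<gamma> where "\<gamma> = (\<lambda>k. ?l (g k) (gen r))"
  have "?l (c k * g k) (0 + gen r) = ?l (c k) 0 * ?l (g k) (gen r)" if "k < b 0" for k
    using only g_exps[OF that] by (intro lookup_mult_unique) auto
  then have one: "(\<Sum>k<b 0. ?l (c k) 0 * \<gamma> k) = 1"
    using arg_cong[OF c, of "\<lambda>p. ?l p (gen r)"] by (simp add: lookup_sum \<gamma>_def)
  \<comment> \<open>The degree of the assumed resolution is not known beforehand; it is read off
    from a generator that involves \<open>gen r\<close>.\<close>
  have d: "d = int (2 * r)"
  proof -
    obtain k where k: "k < b 0" "\<gamma> k \<noteq> 0"
      using one by (metis (no_types, lifting) lessThan_iff mult_zero_right sum.neutral zero_neq_one)
    then have "gen r \<in> Poly_Mapping.keys (g k)"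
      by (simp add: \<gamma>_def in_keys_iff)
    then show ?thesis
      using hom_g[OF k(1)] mdeg_gen[of r] by (auto simp: homog_def)
  qed
  have kill: "(\<Sum>k<b 0. Poly_Mapping.single 0 (\<gamma> k) * M 1 k j) = 0" if j: "j < b 1" for j
  proof (rule poly_mapping_eqI)
    fix x
    have syz: "(\<Sum>k<b 0. M 1 k j * g k) = 0"
      unfolding exact using j
      by (intro exI[of _ "\<lambda>i. if i = j then 1 else 0"]) (simp add: if_distrib[where f = "\<lambda>c. _ * c"] cong: if_cong)
    have lin: "?l (Poly_Mapping.single 0 (\<gamma> k) * M 1 k j) x = \<gamma> k * ?l (M 1 k j) x" for k
      using lookup_single_mult[of 0 "\<gamma> k" "M 1 k j" x] by simp
    show "?l (\<Sum>k<b 0. Poly_Mapping.single 0 (\<gamma> k) * M 1 k j) x = ?l 0 x"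
    proof (cases "mdeg x = 1")
      case True
      \<comment> \<open>As \<open>x\<close> is a single variable, \<open>y\<close> misses
        \<open>u\<close> or \<open>w\<close>. Then its exponents at \<open>s\<close> and
        \<open>t\<close> are at least \<open>r\<close>, and its degree \<open>2 * r\<close> leaves
        only \<open>gen r\<close>.\<close>
      have "?l (M 1 k j * g k) (x + gen r) = ?l (M 1 k j) x * ?l (g k) (gen r)" if k: "k < b 0" for k
      proof (rule lookup_mult_unique)
        fix x' y assume x': "x' \<in> Poly_Mapping.keys (M 1 k j)" and y: "y \<in> Poly_Mapping.keys (g k)" and eq: "x' + y = x + gen r"
        have "y \<in> exps" "mdeg y = 2 * r"
          using g_exps[OF k] hom_g[OF k] y d by (auto simp: homog_def)
        moreover have "Poly_Mapping.lookup x' v + Poly_Mapping.lookup y v = Poly_Mapping.lookup x v + Poly_Mapping.lookup (gen r) v" for v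
          using eq by (metis lookup_add)
        note this[of s] this[of t] this[of u] this[of w]
        ultimately have "y = gen r"
          using True unfolding eq_iff mdeg_distinct[OF dist univ] exps_def by (simp add: lookup_gen)
        then show "x' = x \<and> y = gen r"
          using eq by simp
      qed
      then have "0 = (\<Sum>k<b 0. \<gamma> k * ?l (M 1 k j) x)"
        using arg_cong[OF syz, of "\<lambda>p. ?l p (x + gen r)"] by (simp add: lookup_sum \<gamma>_def mult.commute)
      then show ?thesis
        unfolding lookup_sum lin by simp
    next
      case False
      then have "?l (M 1 k j) x = 0" if "k < b 0" for k
        using hom_M[OF that j] by (auto simp: homog_def in_keys_iff)
      then show ?thesis
        unfolding lookup_sum lin by simp
    qed
  qed
  let ?P = "Poly_Mapping.single s 1 + Poly_Mapping.single t 1" and ?Q = "Poly_Mapping.single u 1 + Poly_Mapping.single w 1"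
  define v where "v = (\<lambda>k. Poly_Mapping.single ?Q 1 * c k - Poly_Mapping.single ?P 1 * c' k)"
  have "?Q + gen r = ?P + gen (r - 1)"
    unfolding eq_iff using r by (auto simp: lookup_add lookup_gen lookup_single when_def neq)
  then have "(\<Sum>k<b 0. v k * g k) = 0"
  proof -
    have "(\<Sum>k<b 0. v k * g k) = Poly_Mapping.single ?Q 1 * (\<Sum>k<b 0. c k * g k) - Poly_Mapping.single ?P 1 * (\<Sum>k<b 0. c' k * g k)"
      by (simp add: v_def left_diff_distrib sum_subtractf sum_distrib_left mult.assoc)
    also have "\<dots> = 0"
      using \<open>?Q + gen r = _\<close> by (simp add: mult_single flip: c c')
    finally show ?thesis .
  qed
  then obtain z where z: "\<And>k. k < b 0 \<Longrightarrow> v k = (\<Sum>j<b 1. M 1 k j * z j)"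
    unfolding exact by blast
  have "(\<Sum>k<b 0. Poly_Mapping.single 0 (\<gamma> k) * v k) = (\<Sum>k<b 0. \<Sum>j<b 1. Poly_Mapping.single 0 (\<gamma> k) * M 1 k j * z j)"
    by (simp add: z sum_distrib_left mult.assoc)
  also have "\<dots> = (\<Sum>j<b 1. (\<Sum>k<b 0. Poly_Mapping.single 0 (\<gamma> k) * M 1 k j) * z j)"
    by (subst sum.swap) (simp add: sum_distrib_right)
  finally have "(\<Sum>k<b 0. Poly_Mapping.single 0 (\<gamma> k) * v k) = 0"
    using kill by simp
  \<comment> \<open>\<open>x_u x_w\<close> is not a multiple of \<open>x_s x_t\<close>, so the part
    with \<open>c' k\<close> contributes nothing. What remains sums to the value 1 found in
    \<open>one\<close>.\<close>
  moreover have "?l (Poly_Mapping.single 0 (\<gamma> k) * v k) ?Q = ?l (c k) 0 * \<gamma> k" for k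
  proof -
    have "?Q \<notin> Poly_Mapping.keys (Poly_Mapping.single ?P 1 * c' k)"
      unfolding keys_single_mult eq_iff image_iff by (simp add: lookup_add lookup_single when_def neq)
    then have "?l (Poly_Mapping.single ?P 1 * c' k) ?Q = 0"
      by (simp add: in_keys_iff)
    moreover have "?l (Poly_Mapping.single ?Q 1 * c k) ?Q = ?l (c k) 0"
      using lookup_single_mult[of ?Q 1 "c k" 0] by simp
    ultimately show ?thesis
      using lookup_single_mult[of 0 "\<gamma> k" "v k" ?Q] by (simp add: v_def lookup_minus)
  qed
  ultimately have "(\<Sum>k<b 0. ?l (c k) 0 * \<gamma> k) = 0"
    using lookup_sum[of "\<lambda>k. Poly_Mapping.single 0 (\<gamma> k) * v k" "{..<b 0}" ?Q] by simp
  then show False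
    using one by simp
qed

text \<open>The ideal is generated in degree \<open>2 * r\<close>, so it equals the ideal generated
  by its component of that degree.\<close>

lemma not_comp_linear_exps:
  assumes "r \<ge> 1"
  shows "\<not> comp_linear (mono_ideal exps :: 'k::field mpoly4 set)"
proof -
  have "upset {m \<in> exps. mdeg m = 2 * r} = exps"
  proof
    show "upset {m \<in> exps. mdeg m = 2 * r} \<subseteq> exps"
      unfolding upset_def using exps_add by blast
    show "exps \<subseteq> upset {m \<in> exps. mdeg m = 2 * r}"
      by (subst exps_eq_upset) (auto simp: upset_def mdeg_gen exps_def lookup_gen)
  qed
  then have "ideal_gen {p \<in> mono_ideal exps. homog p (int (2 * r))} = (mono_ideal exps :: 'k mpoly4 set)"
    using ideal_gen_degree_component[of exps "2 * r", where 'k = 'k] exps_add by simp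
  then show ?thesis
    unfolding comp_linear_def using not_linear_res_exps[OF assms] by metis
qed

end

section \<open>Permutations of the curve (0,r,r,r,r,0)\<close>

text \<open>The two edges of weight 0 are opposite, so they amount to a fixed-point-free involution
  of the variables. Conjugating it by \<open>\<sigma>\<close> gives another one, and there are only
  three; no enumeration of the 24 permutations is required.\<close>

lemma perm_rel_special_cases:
  fixes a :: "nat \<Rightarrow> nat"
  assumes "inj \<sigma>" "surj \<sigma>" "r \<ge> 1" and rel: "perm_rel \<sigma> (special_curve r) a"
  shows "(a 1 = 0 \<and> a 6 = 0 \<and> a 2 = a 3 \<and> a 2 = a 4 \<and> a 2 = a 5 \<and> a 2 \<ge> 1) \<or>
    (a 2 = 0 \<and> a 5 = 0 \<and> a 1 = a 3 \<and> a 1 = a 4 \<and> a 1 = a 6 \<and> a 1 \<ge> 1) \<or>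
    (a 3 = 0 \<and> a 4 = 0 \<and> a 1 = a 2 \<and> a 1 = a 5 \<and> a 1 = a 6 \<and> a 1 \<ge> 1)"
proof -
  \<comment> \<open>The number of the edge \<open>xy\<close>, inverse to \<open>pair\<close>; the
    default 6 stands for the edge \<open>CD\<close>.\<close>
  define idx :: "var \<Rightarrow> var \<Rightarrow> nat" where
    "idx = (\<lambda>x y. if {x, y} = {A, B} then 1 else if {x, y} = {A, C} then 2 else if {x, y} = {A, D} then 3
      else if {x, y} = {B, C} then 4 else if {x, y} = {B, D} then 5 else 6)"
  define \<tau> where "\<tau> = (\<lambda>v. case v of A \<Rightarrow> B | B \<Rightarrow> A | C \<Rightarrow> D | D \<Rightarrow> C)"
  have idx_simps: "idx A B = 1" "idx B A = 1" "idx A C = 2" "idx C A = 2" "idx A D = 3" "idx D A = 3"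
      "idx B C = 4" "idx C B = 4" "idx B D = 5" "idx D B = 5" "idx C D = 6" "idx D C = 6"
    by (simp_all add: idx_def doubleton_eq_iff)
  have idx: "idx x y \<in> {1..6} \<and> {fst (pair (idx x y)), snd (pair (idx x y))} = {x, y}" if "x \<noteq> y" for x y
    using that by (cases x; cases y) (simp_all add: idx_simps pair_def insert_commute)
  have special: "special_curve r (idx x y) = (if y = \<tau> x then 0 else r)" if "x \<noteq> y" for x y
    using that by (cases x; cases y) (simp_all add: idx_simps special_curve_def \<tau>_def)
  have image: "{\<sigma> x, \<sigma> y} = \<sigma> ` {x, y}" for x y
    by simp
  have edge: "a (idx (\<sigma> x) (\<sigma> y)) = (if y = \<tau> x then 0 else r)" if "x \<noteq> y" for x y
  proof -
    have "\<sigma> x \<noteq> \<sigma> y"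
      using that \<open>inj \<sigma>\<close> by (simp add: inj_eq)
    have "{\<sigma> (fst (pair (idx x y))), \<sigma> (snd (pair (idx x y)))} = {\<sigma> x, \<sigma> y}"
      unfolding image using idx[OF that] by simp
    then have "a (idx (\<sigma> x) (\<sigma> y)) = special_curve r (idx x y)"
      using rel idx[OF that] idx[OF \<open>\<sigma> x \<noteq> \<sigma> y\<close>] unfolding perm_rel_def by simp
    then show ?thesis
      using special[OF that] by simp
  qed
  \<comment> \<open>\<open>\<pi>\<close> exchanges the ends of each of the two opposite edges of weight 0.\<close>
  define \<pi> where "\<pi> = (\<lambda>v. \<sigma> (\<tau> (inv \<sigma> v)))"
  have \<tau>: "\<tau> v \<noteq> v" "\<tau> (\<tau> v) = v" for v
    by (cases v; simp add: \<tau>_def)+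
  have \<sigma>: "\<sigma> (inv \<sigma> v) = v" "inv \<sigma> (\<sigma> v) = v" for v
    using \<open>inj \<sigma>\<close> \<open>surj \<sigma>\<close> by (simp_all add: surj_f_inv_f)
  have \<pi>: "\<pi> v \<noteq> v" "\<pi> (\<pi> v) = v" for v
  proof -
    show "\<pi> v \<noteq> v"
      using \<tau>(1)[of "inv \<sigma> v"] \<sigma>(2)[of "\<tau> (inv \<sigma> v)"] unfolding \<pi>_def by auto
    show "\<pi> (\<pi> v) = v"
      unfolding \<pi>_def \<sigma>(2) \<tau>(2) \<sigma>(1) ..
  qed
  have edge': "a (idx x y) = (if y = \<pi> x then 0 else r)" if "x \<noteq> y" for x y
  proof -
    have "inv \<sigma> x \<noteq> inv \<sigma> y"
      using \<sigma>(1)[of x] \<sigma>(1)[of y] that by auto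
    moreover have "inv \<sigma> y = \<tau> (inv \<sigma> x) \<longleftrightarrow> y = \<pi> x"
      using \<sigma>(1)[of y] \<sigma>(2)[of "\<tau> (inv \<sigma> x)"] unfolding \<pi>_def by auto
    ultimately show ?thesis
      using edge[of "inv \<sigma> x" "inv \<sigma> y"] by (simp add: \<sigma>(1))
  qed
  have "a 1 = (if B = \<pi> A then 0 else r)" "a 2 = (if C = \<pi> A then 0 else r)" "a 3 = (if D = \<pi> A then 0 else r)"
    "a 4 = (if C = \<pi> B then 0 else r)" "a 5 = (if D = \<pi> B then 0 else r)" "a 6 = (if D = \<pi> C then 0 else r)"
    using edge'[of A B] edge'[of A C] edge'[of A D] edge'[of B C] edge'[of B D] edge'[of C D]
    by (simp_all add: idx_simps)
  moreover have "\<pi> A = B \<and> \<pi> B = A \<and> \<pi> C = D \<or> \<pi> A = C \<and> \<pi> B = D \<and> \<pi> C = A \<or> \<pi> A = D \<and> \<pi> B = C \<and> \<pi> C = B"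
    using \<pi>[of A] \<pi>[of B] \<pi>[of C] by (cases "\<pi> A"; cases "\<pi> B"; cases "\<pi> C") simp_all
  ultimately show ?thesis
    using \<open>r \<ge> 1\<close> by auto
qed
lemma up_to_perm_special_iff:
  "up_to_perm_special a \<longleftrightarrow>
    (a 1 = 0 \<and> a 6 = 0 \<and> a 2 = a 3 \<and> a 2 = a 4 \<and> a 2 = a 5 \<and> a 2 \<ge> 1) \<or>
    (a 2 = 0 \<and> a 5 = 0 \<and> a 1 = a 3 \<and> a 1 = a 4 \<and> a 1 = a 6 \<and> a 1 \<ge> 1) \<or>
    (a 3 = 0 \<and> a 4 = 0 \<and> a 1 = a 2 \<and> a 1 = a 5 \<and> a 1 = a 6 \<and> a 1 \<ge> 1)"
proof
  assume "up_to_perm_special a"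
  then obtain \<sigma> r where "inj \<sigma>" "surj \<sigma>" "r \<ge> 1" "perm_rel \<sigma> (special_curve r) a"
    unfolding up_to_perm_special_def bij_def by blast
  then show "(a 1 = 0 \<and> a 6 = 0 \<and> a 2 = a 3 \<and> a 2 = a 4 \<and> a 2 = a 5 \<and> a 2 \<ge> 1) \<or>
    (a 2 = 0 \<and> a 5 = 0 \<and> a 1 = a 3 \<and> a 1 = a 4 \<and> a 1 = a 6 \<and> a 1 \<ge> 1) \<or>
    (a 3 = 0 \<and> a 4 = 0 \<and> a 1 = a 2 \<and> a 1 = a 5 \<and> a 1 = a 6 \<and> a 1 \<ge> 1)"
    by (rule perm_rel_special_cases)
next
  have special: "up_to_perm_special a" if "perm_rel \<sigma> (special_curve r) a" "\<And>v. \<sigma> (\<sigma> v) = v" "r \<ge> 1" for \<sigma> r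
    unfolding up_to_perm_special_def using that by (metis involuntory_imp_bij)
  \<comment> \<open>The identity and two transpositions suffice: exchanging \<open>B\<close> with
    \<open>C\<close>, or \<open>B\<close> with \<open>D\<close>, carries \<open>AB|CD\<close> to the
    other two pairings.\<close>
  let ?s = "\<lambda>x y v. if v = x then y else if v = y then x else v :: var"
  assume "(a 1 = 0 \<and> a 6 = 0 \<and> a 2 = a 3 \<and> a 2 = a 4 \<and> a 2 = a 5 \<and> a 2 \<ge> 1) \<or>
    (a 2 = 0 \<and> a 5 = 0 \<and> a 1 = a 3 \<and> a 1 = a 4 \<and> a 1 = a 6 \<and> a 1 \<ge> 1) \<or>
    (a 3 = 0 \<and> a 4 = 0 \<and> a 1 = a 2 \<and> a 1 = a 5 \<and> a 1 = a 6 \<and> a 1 \<ge> 1)"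
  then show "up_to_perm_special a"
  proof (elim disjE)
    assume *: "a 1 = 0 \<and> a 6 = 0 \<and> a 2 = a 3 \<and> a 2 = a 4 \<and> a 2 = a 5 \<and> a 2 \<ge> 1"
    have "perm_rel (\<lambda>v. v) (special_curve (a 2)) a"
      using * unfolding perm_rel_def atLeastAtMost_1_6
      by (simp add: pair_def special_curve_def doubleton_eq_iff)
    from special[OF this] show ?thesis using * by auto
  next
    assume *: "a 2 = 0 \<and> a 5 = 0 \<and> a 1 = a 3 \<and> a 1 = a 4 \<and> a 1 = a 6 \<and> a 1 \<ge> 1"
    have "perm_rel (?s B C) (special_curve (a 1)) a"
      using * unfolding perm_rel_def atLeastAtMost_1_6
      by (simp add: pair_def special_curve_def doubleton_eq_iff)
    from special[OF this] show ?thesis using * by auto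
  next
    assume *: "a 3 = 0 \<and> a 4 = 0 \<and> a 1 = a 2 \<and> a 1 = a 5 \<and> a 1 = a 6 \<and> a 1 \<ge> 1"
    have "perm_rel (?s B D) (special_curve (a 1)) a"
      using * unfolding perm_rel_def atLeastAtMost_1_6
      by (simp add: pair_def special_curve_def doubleton_eq_iff)
    from special[OF this] show ?thesis using * by auto
  qed
qed

lemma special_resolution:
  assumes "up_to_perm_special a"
  shows "pure_res (tet_ideal a :: 'k::field mpoly4 set) \<and> \<not> linear_res (tet_ideal a :: 'k mpoly4 set) \<and>
    \<not> comp_linear (tet_ideal a :: 'k mpoly4 set)"
proof -
  have concl: ?thesis if "opposite_edges s t u w" "tet_exps a = opposite_edges.exps s t u w r" "r \<ge> 1" for s t u w r
    unfolding tet_ideal_eq that(2)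
    using opposite_edges.pure_res_exps[OF that(1)] opposite_edges.not_linear_res_exps[OF that(1,3)]
      opposite_edges.not_comp_linear_exps[OF that(1,3)] by blast
  have edges: "opposite_edges A B C D" "opposite_edges A C B D" "opposite_edges A D B C"
    by unfold_locales (auto simp: UNIV_var)
  show ?thesis
    using assms unfolding up_to_perm_special_iff
  proof (elim disjE)
    assume *: "a 1 = 0 \<and> a 6 = 0 \<and> a 2 = a 3 \<and> a 2 = a 4 \<and> a 2 = a 5 \<and> a 2 \<ge> 1"
    then have "tet_exps a = opposite_edges.exps A B C D (a 2)"
      unfolding tet_exps_def opposite_edges.exps_def[OF edges(1)] by auto
    then show ?thesis using concl edges * by blast
  next
    assume *: "a 2 = 0 \<and> a 5 = 0 \<and> a 1 = a 3 \<and> a 1 = a 4 \<and> a 1 = a 6 \<and> a 1 \<ge> 1"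
    then have "tet_exps a = opposite_edges.exps A C B D (a 1)"
      unfolding tet_exps_def opposite_edges.exps_def[OF edges(2)] by (auto simp: add.commute)
    then show ?thesis using concl edges * by blast
  next
    assume *: "a 3 = 0 \<and> a 4 = 0 \<and> a 1 = a 2 \<and> a 1 = a 5 \<and> a 1 = a 6 \<and> a 1 \<ge> 1"
    then have "tet_exps a = opposite_edges.exps A D B C (a 1)"
      unfolding tet_exps_def opposite_edges.exps_def[OF edges(3)] by (auto simp: add.commute)
    then show ?thesis using concl edges * by blast
  qed
qed

section \<open>Minimal generators and reductions\<close>

lemma min_generator_monomial:
  "min_generator (mono_ideal U :: 'k::field mpoly4 set) (Poly_Mapping.single m 1) \<longleftrightarrow>
    m \<in> U \<and> m \<notin> upset (var_mult U)"
proof -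
  have "ideal_gen {X v * h | v h. h \<in> mono_ideal U} = (mono_ideal (upset (var_mult U)) :: 'k mpoly4 set)"
  proof (rule ideal_gen_eq_mono_ideal)
    show "{X v * h | v h. h \<in> mono_ideal U} \<subseteq> (mono_ideal (upset (var_mult U)) :: 'k mpoly4 set)"
      unfolding mono_ideal_def X_def
      by (auto simp: keys_single_mult[simplified] var_mult_def intro!: upset_base) blast
    fix n assume "n \<in> var_mult U"
    then obtain v f where f: "n = Poly_Mapping.single v 1 + f" "f \<in> U"
      unfolding var_mult_def by blast
    then have "Poly_Mapping.single n 1 = X v * Poly_Mapping.single f (1 :: 'k)"
      by (simp add: X_def mult_single)
    moreover have "Poly_Mapping.single f (1 :: 'k) \<in> mono_ideal U"
      using f(2) by (simp add: single_in_mono_ideal)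
    ultimately show "Poly_Mapping.single n 1 \<in> ideal_gen {X v * h | v h. h \<in> (mono_ideal U :: 'k mpoly4 set)}"
      by (intro ideal_gen_base) blast
  qed
  then show ?thesis
    by (simp add: min_generator_def single_in_mono_ideal)
qed

lemma min_generator_tet:
  "min_generator (tet_ideal a :: 'k::field mpoly4 set) (Poly_Mapping.single m 1) \<longleftrightarrow>
    m \<in> tet_exps a \<and> (\<forall>v. Poly_Mapping.lookup m v \<noteq> 0 \<longrightarrow> m - Poly_Mapping.single v 1 \<notin> tet_exps a)"
proof -
  have "upset (var_mult (tet_exps a)) = {Poly_Mapping.single v 1 + f | v f. f \<in> tet_exps a}"
  proof
    show "upset (var_mult (tet_exps a)) \<subseteq> {Poly_Mapping.single v 1 + f | v f. f \<in> tet_exps a}"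
    proof
      fix k assume "k \<in> upset (var_mult (tet_exps a))"
      then obtain v f g where "k = Poly_Mapping.single v 1 + (f + g)" "f \<in> tet_exps a"
        unfolding upset_def var_mult_def by (auto simp: add.assoc)
      moreover from this(2) have "f + g \<in> tet_exps a"
        by (auto simp: tet_exps_def lookup_add)
      ultimately show "k \<in> {Poly_Mapping.single v 1 + f | v f. f \<in> tet_exps a}"
        by blast
    qed
  qed (auto simp: var_mult_def intro!: upset_base)
  moreover have "(\<exists>f. m = Poly_Mapping.single v 1 + f \<and> f \<in> tet_exps a) \<longleftrightarrow>
      Poly_Mapping.lookup m v \<noteq> 0 \<and> m - Poly_Mapping.single v 1 \<in> tet_exps a" for v
  proof
    assume "Poly_Mapping.lookup m v \<noteq> 0 \<and> m - Poly_Mapping.single v 1 \<in> tet_exps a"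
    moreover from this obtain f where "m = Poly_Mapping.single v 1 + f"
      by (metis split_off_variable)
    ultimately show "\<exists>f. m = Poly_Mapping.single v 1 + f \<and> f \<in> tet_exps a"
      by (intro exI[of _ f]) simp
  qed (auto simp: lookup_add)
  ultimately show ?thesis
    unfolding tet_ideal_eq min_generator_monomial by blast
qed

text \<open>Here \<open>x\<close>, \<open>y\<close>, \<open>z\<close> are the entries of the facet,
  and \<open>p\<close>, \<open>q\<close>, \<open>k\<close> are the edges opposite to its vertex,
  closing the triangles on \<open>xy\<close>, \<open>xz\<close>, \<open>yz\<close>. The conditions
  \<open>w\<close> compare the weight of the facet with those of the other three.\<close>

lemma reduction_arith:
  fixes x y z p q k :: nat
  assumes "p \<le> x + y" "q \<le> x + z" "k \<le> y + z" and w: "p + q \<le> y + z" "p + k \<le> x + z" "q + k \<le> x + y"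
    and "x + y + z > 0"
  shows "(x = 0 \<or> x + y = p \<or> x + z = q) \<and> (y = 0 \<or> x + y = p \<or> y + z = k) \<and> (z = 0 \<or> x + z = q \<or> y + z = k) \<longleftrightarrow>
    (x = 0 \<and> k = 0 \<and> y = z \<and> y = p \<and> y = q \<and> y \<ge> 1) \<or>
    (y = 0 \<and> q = 0 \<and> x = z \<and> x = p \<and> x = k \<and> x \<ge> 1) \<or>
    (z = 0 \<and> p = 0 \<and> x = y \<and> x = q \<and> x = k \<and> x \<ge> 1)" (is "?L \<longleftrightarrow> ?R")
proof
  assume L: ?L
  have imp: "x + y = p \<Longrightarrow> x + q \<le> z \<and> y + k \<le> z" "x + z = q \<Longrightarrow> x + p \<le> y \<and> z + k \<le> y"
      "y + z = k \<Longrightarrow> y + p \<le> x \<and> z + q \<le> x"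
    using w by linarith+
  \<comment> \<open>If all three were positive, two of the triangles would be tight; by
    \<open>imp\<close>, tightness of \<open>p\<close> and \<open>q\<close> gives
    \<open>x = 0\<close>, and the other pairs are analogous.\<close>
  have "x = 0 \<or> y = 0 \<or> z = 0"
    using L imp by auto
  then show ?R
  proof (elim disjE)
    assume "x = 0"
    then have "y = p \<and> z = q"
      using L imp w assms(7) by auto
    then show ?R
      using \<open>x = 0\<close> w assms(7) by auto
  next
    assume "y = 0"
    then have "x = p \<and> z = k"
      using L imp w assms(7) by auto
    then show ?R
      using \<open>y = 0\<close> w assms(7) by auto
  next
    assume "z = 0"
    then have "x = q \<and> y = k"
      using L imp w assms(7) by auto
    then show ?R
      using \<open>z = 0\<close> w assms(7) by auto
  qed
qed (use assms in auto)

text \<open>The reduction condition puts \<open>F\<close> into \<open>I\<close>. The edges at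
  \<open>v\<close> are lowered by one in \<open>I\<close>, so dividing \<open>F\<close> by a
  variable that occurs in it cannot violate them. Leaving \<open>I\<close> therefore means that an
  opposite edge through that variable is tight.\<close>

lemma min_generator_reduction:
  assumes "nontrivial a" and red: "red_cond v a" and wt: "\<And>u. weight u a \<le> weight v a"
  shows "min_generator (tet_ideal (red_curve v a) :: 'k::field mpoly4 set) (red_mono v a) \<longleftrightarrow> up_to_perm_special a"
proof -
  have all: "(\<forall>v. P v) \<longleftrightarrow> P A \<and> P B \<and> P C \<and> P D" for P
    by (metis var.exhaust)
  have weights: "weight A a = a 1 + a 2 + a 3" "weight B a = a 1 + a 4 + a 5"
      "weight C a = a 2 + a 4 + a 6" "weight D a = a 3 + a 5 + a 6"
    by (simp_all add: weight_def facet_def)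
  \<comment> \<open>A maximal weight of 0 would make every facet, and so the whole curve,
    trivial.\<close>
  have pos: "weight v a > 0"
  proof (rule ccontr)
    assume "\<not> weight v a > 0"
    then have "weight u a = 0" for u
      using wt[of u] by simp
    then have "a 1 + a 2 + a 3 = 0" "a 1 + a 4 + a 5 = 0" "a 2 + a 4 + a 6 = 0"
      using weights by metis+
    then show False
      using \<open>nontrivial a\<close> unfolding nontrivial_def atLeastAtMost_1_6 by auto
  qed
  note wts = wt[of A] wt[of B] wt[of C] wt[of D]
  note unfold = red_mono_def X_power mult_single var.case mult_1 min_generator_tet all
  note calc = tet_exps_def red_curve_def facet_def lookup_add lookup_minus lookup_single when_def
  show ?thesis
  proof (cases v)
    case A
    have "min_generator (tet_ideal (red_curve v a) :: 'k mpoly4 set) (red_mono v a) \<longleftrightarrow>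
      (a 1 = 0 \<or> a 1 + a 2 = a 4 \<or> a 1 + a 3 = a 5) \<and> (a 2 = 0 \<or> a 1 + a 2 = a 4 \<or> a 2 + a 3 = a 6) \<and>
      (a 3 = 0 \<or> a 1 + a 3 = a 5 \<or> a 2 + a 3 = a 6)"
      using red unfolding A unfold by (auto simp: calc red_cond_def)
    also have "\<dots> \<longleftrightarrow> up_to_perm_special a"
    proof -
      have "a 4 \<le> a 1 + a 2" "a 5 \<le> a 1 + a 3" "a 6 \<le> a 2 + a 3" "a 4 + a 5 \<le> a 2 + a 3" "a 4 + a 6 \<le> a 1 + a 3"
          "a 5 + a 6 \<le> a 1 + a 2" "a 1 + a 2 + a 3 > 0"
        using red wts pos unfolding A weights by (simp_all add: red_cond_def)
      from reduction_arith[OF this] show ?thesis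
        unfolding up_to_perm_special_iff by (simp only:; intro iffI; elim disjE conjE; simp)
    qed
    finally show ?thesis .
  next
    case B
    have "min_generator (tet_ideal (red_curve v a) :: 'k mpoly4 set) (red_mono v a) \<longleftrightarrow>
      (a 1 = 0 \<or> a 1 + a 4 = a 2 \<or> a 1 + a 5 = a 3) \<and> (a 4 = 0 \<or> a 1 + a 4 = a 2 \<or> a 4 + a 5 = a 6) \<and>
      (a 5 = 0 \<or> a 1 + a 5 = a 3 \<or> a 4 + a 5 = a 6)"
      using red unfolding B unfold by (auto simp: calc red_cond_def)
    also have "\<dots> \<longleftrightarrow> up_to_perm_special a"
    proof -
      have "a 2 \<le> a 1 + a 4" "a 3 \<le> a 1 + a 5" "a 6 \<le> a 4 + a 5" "a 2 + a 3 \<le> a 4 + a 5" "a 2 + a 6 \<le> a 1 + a 5"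
          "a 3 + a 6 \<le> a 1 + a 4" "a 1 + a 4 + a 5 > 0"
        using red wts pos unfolding B weights by (simp_all add: red_cond_def)
      from reduction_arith[OF this] show ?thesis
        unfolding up_to_perm_special_iff by (simp only:; intro iffI; elim disjE conjE; simp)
    qed
    finally show ?thesis .
  next
    case C
    have "min_generator (tet_ideal (red_curve v a) :: 'k mpoly4 set) (red_mono v a) \<longleftrightarrow>
      (a 2 = 0 \<or> a 2 + a 4 = a 1 \<or> a 2 + a 6 = a 3) \<and> (a 4 = 0 \<or> a 2 + a 4 = a 1 \<or> a 4 + a 6 = a 5) \<and>
      (a 6 = 0 \<or> a 2 + a 6 = a 3 \<or> a 4 + a 6 = a 5)"
      using red unfolding C unfold by (auto simp: calc red_cond_def)
    also have "\<dots> \<longleftrightarrow> up_to_perm_special a"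
    proof -
      have "a 1 \<le> a 2 + a 4" "a 3 \<le> a 2 + a 6" "a 5 \<le> a 4 + a 6" "a 1 + a 3 \<le> a 4 + a 6" "a 1 + a 5 \<le> a 2 + a 6"
          "a 3 + a 5 \<le> a 2 + a 4" "a 2 + a 4 + a 6 > 0"
        using red wts pos unfolding C weights by (simp_all add: red_cond_def)
      from reduction_arith[OF this] show ?thesis
        unfolding up_to_perm_special_iff by (simp only:; intro iffI; elim disjE conjE; simp)
    qed
    finally show ?thesis .
  next
    case D
    have "min_generator (tet_ideal (red_curve v a) :: 'k mpoly4 set) (red_mono v a) \<longleftrightarrow>
      (a 3 = 0 \<or> a 3 + a 5 = a 1 \<or> a 3 + a 6 = a 2) \<and> (a 5 = 0 \<or> a 3 + a 5 = a 1 \<or> a 5 + a 6 = a 4) \<and>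
      (a 6 = 0 \<or> a 3 + a 6 = a 2 \<or> a 5 + a 6 = a 4)"
      using red unfolding D unfold by (auto simp: calc red_cond_def)
    also have "\<dots> \<longleftrightarrow> up_to_perm_special a"
    proof -
      have "a 1 \<le> a 3 + a 5" "a 2 \<le> a 3 + a 6" "a 4 \<le> a 5 + a 6" "a 1 + a 2 \<le> a 5 + a 6" "a 1 + a 4 \<le> a 3 + a 6"
          "a 2 + a 4 \<le> a 3 + a 5" "a 3 + a 5 + a 6 > 0"
        using red wts pos unfolding D weights by (simp_all add: red_cond_def)
      from reduction_arith[OF this] show ?thesis
        unfolding up_to_perm_special_iff by (simp only:; intro iffI; elim disjE conjE; simp)
    qed
    finally show ?thesis .
  qed
qed

theorem theorem4p8:
  fixes a :: "nat \<Rightarrow> nat" and J :: "'k::field mpoly4 set"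
  defines "J \<equiv> tet_ideal a"
  assumes "nontrivial a"
  shows "(minimal_curve a TYPE('k) \<longrightarrow> linear_res J \<and> comp_linear J)
       \<and> (up_to_perm_special a \<longrightarrow> pure_res J \<and> \<not> linear_res J \<and> \<not> comp_linear J)
       \<and> (\<forall>v. red_cond v a \<and> (\<forall>u. weight u a \<le> weight v a) \<longrightarrow>
              (min_generator (tet_ideal (red_curve v a) :: 'k mpoly4 set) (red_mono v a)
                 \<longleftrightarrow> up_to_perm_special a))"
proof (intro conjI impI allI)
  assume "minimal_curve a TYPE('k)"
  then obtain d where "linear_quotients d (tet_exps a)"
    unfolding minimal_curve_def using not_reducible_linear_quotients by blast
  then show "linear_res J" "comp_linear J"
    unfolding J_def tet_ideal_eq by (rule linear_quotients_linear_res)+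
next
  assume "up_to_perm_special a"
  from special_resolution[OF this, where 'k = 'k]
  show "pure_res J" "\<not> linear_res J" "\<not> comp_linear J"
    unfolding J_def by blast+
next
  fix v assume "red_cond v a \<and> (\<forall>u. weight u a \<le> weight v a)"
  then show "min_generator (tet_ideal (red_curve v a) :: 'k mpoly4 set) (red_mono v a)
      \<longleftrightarrow> up_to_perm_special a"
    using assms(2) by (intro min_generator_reduction) auto
qed

end
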